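(* Let $\Omega\subseteq\mathbb{R}^n$ be open and let $D=\Omega$ or $D=\bar\Omega$. Let $\mathcal{A}\subseteq\mathcal{G}(D)$ and $\mathcal{L}:\mathcal{A}\to\tilde{\mathbb{R}}$. Let $\mathcal{A}_0$ be an $\tilde{\mathbb{R}}$-submodule of $\mathcal{G}(D)$ with $\mathcal{A}+\mathcal{A}_0\subseteq\mathcal{A}$, and suppose that for all $u\in\mathcal{A}$ and $v\in\mathcal{A}_0$ the mapping $\mathcal{L}^{u,v}:s\mapsto\mathcal{L}(u+sv)$ is an element of $\mathcal{G}(J^{u,v})$, where $J^{u,v}$ is some open interval around $0$ in $\mathbb{R}$. Let $u\in\mathcal{A}$ be a minimizer of $\mathcal{L}$ in $\mathcal{A}$, i.e. $\mathcal{L}(u)\le\mathcal{L}(w)$ in $\tilde{\mathbb{R}}$ for all $w\in\mathcal{A}$. Then (i) $\delta\mathcal{L}(u;v)=0$ in $\tilde{\mathbb{R}}$ for all $v\in\mathcal{A}_0$; (ii) $\delta^2\mathcal{L}(u;v)\ge0$ in $\tilde{\mathbb{R}}$ for all $v\in\mathcal{A}_0$.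
   Context: For a set $D$ which is an open subset of a Euclidean space or its closure: $\mathcal{E}_M(D)$ is the set of nets $(u_\varepsilon)_{\varepsilon\in(0,1]}$ in $C^\infty(D)$ such that for every compact $K\subset D$ and every multi-index $\alpha$ there is $N\in\mathbb{N}$ with $\sup_K|\partial^\alpha u_\varepsilon|=O(\varepsilon^{-N})$ as $\varepsilon\to0$; $\mathcal{N}(D)$ is the set of nets such that for all $K,\alpha$ and all $m\in\mathbb{N}$, $\sup_K|\partial^\alpha u_\varepsilon|=O(\varepsilon^m)$; $\mathcal{G}(D)=\mathcal{E}_M(D)/\mathcal{N}(D)$. ($C^\infty(\bar\Omega)$: functions smooth in $\Omega$ all of whose derivatives extend continuously to $\bar\Omega$.) $\tilde{\mathbb{R}}$ is the ring of nets of reals with $|x_\varepsilon|=O(\varepsilon^{-N})$ for some $N$, modulo nets with $|x_\varepsilon|=O(\varepsilon^m)$ for all $m$; it acts on $\mathcal{G}(D)$ componentwise. $\tilde x\ge0$ means that $\tilde x$ has a representative with all $x_\varepsilon\ge0$; $\tilde x\le\tilde y$ means $\tilde y-\tilde x\ge0$. For an open interval $J$, $\tilde J_c$ is the set of classes in $\tilde{\mathbb R}$ of nets $(s_\varepsilon)_\varepsilon$ in $J$ that lie in a fixed compact subset of $J$ for all small $\varepsilon$. An element $g\in\mathcal{G}(J)$ has point values $g(\tilde s)=[(g_\varepsilon(s_\varepsilon))_\varepsilon]$ for $\tilde s=[(s_\varepsilon)_\varepsilon]\in\tilde J_c$, and is uniquely determined by them. The assumption "$\mathcal{L}^{u,v}$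 is an element of $\mathcal{G}(J^{u,v})$" means that there is an element of $\mathcal{G}(J^{u,v})$ whose value at each $\tilde s\in(J^{u,v})^{\sim}_c$ is $\mathcal{L}(u+\tilde sv)$. First and second variation: $\delta\mathcal{L}(u;v)=\frac{d}{ds}\big|_{s=0}\mathcal{L}^{u,v}(s)$, $\delta^2\mathcal{L}(u;v)=\frac{d^2}{ds^2}\big|_{s=0}\mathcal{L}^{u,v}(s)$, both in $\tilde{\mathbb{R}}$. *)

theory Defs
  imports "HOL-Analysis.Analysis" "HOL-Library.Landau_Symbols"
begin

section \<open>Generalized real numbers\<close>

text \<open>
  Nets indexed by \<open>(0,1]\<close> are represented by functions on all of \<open>real\<close>; values outside
  \<open>(0,1]\<close> (and, for nets of functions, values outside the domain) are irrelevant, as they are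
  identified in the quotients below. The limit \<open>\<epsilon> \<rightarrow> 0\<close> is the filter \<open>at_right 0\<close>.
\<close>

definition moderate :: "(real \<Rightarrow> real) \<Rightarrow> bool" where
  "moderate x \<longleftrightarrow> (\<exists>N::nat. x \<in> O[at_right 0](\<lambda>\<epsilon>. inverse \<epsilon> ^ N))"

definition negligible_net :: "(real \<Rightarrow> real) \<Rightarrow> bool" where
  "negligible_net x \<longleftrightarrow> (\<forall>m::nat. x \<in> O[at_right 0](\<lambda>\<epsilon>. \<epsilon> ^ m))"

definition gen_real_rel :: "(real \<Rightarrow> real) \<Rightarrow> (real \<Rightarrow> real) \<Rightarrow> bool" where
  "gen_real_rel x y \<longleftrightarrow> moderate x \<and> moderate y \<and> negligible_net (\<lambda>\<epsilon>. x \<epsilon> - y \<epsilon>)"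

lemma inverse_power_bigo:
  assumes "N \<le> M"
  shows "(\<lambda>\<epsilon>::real. inverse \<epsilon> ^ N) \<in> O[at_right 0](\<lambda>\<epsilon>. inverse \<epsilon> ^ M)"
proof (rule bigoI[where c = 1])
  have "eventually (\<lambda>\<epsilon>::real. \<epsilon> \<in> {0<..<1}) (at_right 0)"
    by (rule eventually_at_right_real) simp
  then show "\<forall>\<^sub>F \<epsilon>::real in at_right 0. norm (inverse \<epsilon> ^ N) \<le> 1 * norm (inverse \<epsilon> ^ M)"
  proof eventually_elim
    case (elim \<epsilon>)
    then have "1 \<le> inverse \<epsilon>" by (simp add: one_le_inverse)
    then have "inverse \<epsilon> ^ N \<le> inverse \<epsilon> ^ M" using assms by (rule power_increasing[rotated])
    then show ?case using elim by simp
  qed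
qed

lemma moderate_const: "moderate (\<lambda>_. c)"
  unfolding moderate_def by (rule exI[where x = 0]) simp

lemma moderate_uminus: "moderate x \<Longrightarrow> moderate (\<lambda>\<epsilon>. - x \<epsilon>)"
  unfolding moderate_def by simp

lemma moderate_add:
  assumes "moderate x" "moderate y" shows "moderate (\<lambda>\<epsilon>. x \<epsilon> + y \<epsilon>)"
proof -
  from assms obtain N M where
    "x \<in> O[at_right 0](\<lambda>\<epsilon>. inverse \<epsilon> ^ N)" "y \<in> O[at_right 0](\<lambda>\<epsilon>. inverse \<epsilon> ^ M)"
    unfolding moderate_def by blast
  then have "x \<in> O[at_right 0](\<lambda>\<epsilon>. inverse \<epsilon> ^ max N M)" "y \<in> O[at_right 0](\<lambda>\<epsilon>. inverse \<epsilon> ^ max N M)"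
    using landau_o.big_trans[OF _ inverse_power_bigo[of N "max N M"], of x]
      landau_o.big_trans[OF _ inverse_power_bigo[of M "max N M"], of y] by simp_all
  then show ?thesis unfolding moderate_def by (intro exI[of _ "max N M"] sum_in_bigo(1))
qed

lemma moderate_mult:
  assumes "moderate x" "moderate y" shows "moderate (\<lambda>\<epsilon>. x \<epsilon> * y \<epsilon>)"
proof -
  from assms obtain N M where
    "x \<in> O[at_right 0](\<lambda>\<epsilon>. inverse \<epsilon> ^ N)" "y \<in> O[at_right 0](\<lambda>\<epsilon>. inverse \<epsilon> ^ M)"
    unfolding moderate_def by blast
  from landau_o.big.mult[OF this] show ?thesis
    unfolding moderate_def by (auto simp: power_add[symmetric])
qed

lemma negligible_net_zero: "negligible_net (\<lambda>_. 0)"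
  unfolding negligible_net_def by simp

lemma negligible_net_uminus: "negligible_net x \<Longrightarrow> negligible_net (\<lambda>\<epsilon>. - x \<epsilon>)"
  unfolding negligible_net_def by simp

lemma negligible_net_add:
  "negligible_net x \<Longrightarrow> negligible_net y \<Longrightarrow> negligible_net (\<lambda>\<epsilon>. x \<epsilon> + y \<epsilon>)"
  unfolding negligible_net_def by (simp add: sum_in_bigo)

lemma negligible_net_mult:
  assumes "moderate x" "negligible_net y" shows "negligible_net (\<lambda>\<epsilon>. x \<epsilon> * y \<epsilon>)"
  unfolding negligible_net_def
proof
  fix m :: nat
  from assms(1) obtain N where N: "x \<in> O[at_right 0](\<lambda>\<epsilon>. inverse \<epsilon> ^ N)"
    unfolding moderate_def by blast
  have "y \<in> O[at_right 0](\<lambda>\<epsilon>. \<epsilon> ^ (N + m))"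
    using assms(2) unfolding negligible_net_def by blast
  from landau_o.big.mult[OF N this]
  have "(\<lambda>\<epsilon>. x \<epsilon> * y \<epsilon>) \<in> O[at_right 0](\<lambda>\<epsilon>. inverse \<epsilon> ^ N * \<epsilon> ^ (N + m))" .
  also have "(\<lambda>\<epsilon>::real. inverse \<epsilon> ^ N * \<epsilon> ^ (N + m)) \<in> \<Theta>[at_right 0](\<lambda>\<epsilon>. \<epsilon> ^ m)"
    by (rule bigthetaI_cong, rule eventually_mono[OF eventually_at_right_less])
       (simp add: power_add power_inverse)
  finally show "(\<lambda>\<epsilon>. x \<epsilon> * y \<epsilon>) \<in> O[at_right 0](\<lambda>\<epsilon>. \<epsilon> ^ m)" .
qed

lemma negligible_net_one: "\<not> negligible_net (\<lambda>_. 1)"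
proof
  assume "negligible_net (\<lambda>_. 1)"
  then have "(\<lambda>_. 1::real) \<in> O[at_right 0](\<lambda>\<epsilon>. \<epsilon> ^ 1)" unfolding negligible_net_def by blast
  then obtain c where c: "c > 0" "\<forall>\<^sub>F \<epsilon> in at_right 0. norm (1::real) \<le> c * norm (\<epsilon> ^ 1 :: real)"
    by (elim landau_o.bigE)
  have "eventually (\<lambda>\<epsilon>::real. \<epsilon> \<in> {0<..<1 / c}) (at_right 0)"
    using c(1) by (intro eventually_at_right_real) simp
  with c(2) have "\<forall>\<^sub>F \<epsilon>::real in at_right 0. False"
    by eventually_elim (use c(1) in \<open>auto simp: field_simps\<close>)
  then show False by simp
qed

quotient_type gen_real = "real \<Rightarrow> real" / partial: gen_real_rel
proof (rule part_equivpI)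
  show "\<exists>x. gen_real_rel x x"
    by (rule exI[where x = "\<lambda>_. 0"]) (simp add: gen_real_rel_def moderate_const negligible_net_zero)
  show "symp gen_real_rel"
    by (rule sympI, unfold gen_real_rel_def) (use negligible_net_uminus in fastforce)
  show "transp gen_real_rel"
    by (rule transpI, unfold gen_real_rel_def) (use negligible_net_add in fastforce)
qed

instantiation gen_real :: comm_ring_1
begin

lift_definition zero_gen_real :: gen_real is "\<lambda>_. 0"
  by (simp add: gen_real_rel_def moderate_const negligible_net_zero)

lift_definition one_gen_real :: gen_real is "\<lambda>_. 1"
  by (simp add: gen_real_rel_def moderate_const negligible_net_zero)

lift_definition plus_gen_real :: "gen_real \<Rightarrow> gen_real \<Rightarrow> gen_real" is "\<lambda>x y \<epsilon>. x \<epsilon> + y \<epsilon>"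
  by (unfold gen_real_rel_def, elim conjE, intro conjI moderate_add, assumption+,
      drule (1) negligible_net_add, simp add: algebra_simps)

lift_definition uminus_gen_real :: "gen_real \<Rightarrow> gen_real" is "\<lambda>x \<epsilon>. - x \<epsilon>"
  by (unfold gen_real_rel_def, elim conjE, intro conjI moderate_uminus, assumption+,
      drule negligible_net_uminus, simp)

lift_definition times_gen_real :: "gen_real \<Rightarrow> gen_real \<Rightarrow> gen_real" is "\<lambda>x y \<epsilon>. x \<epsilon> * y \<epsilon>"
proof -
  fix x x' y y' assume *: "gen_real_rel x x'" "gen_real_rel y y'"
  have "negligible_net (\<lambda>\<epsilon>. x \<epsilon> * (y \<epsilon> - y' \<epsilon>) + y' \<epsilon> * (x \<epsilon> - x' \<epsilon>))"
    using * by (intro negligible_net_add negligible_net_mult) (auto simp: gen_real_rel_def)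
  then show "gen_real_rel (\<lambda>\<epsilon>. x \<epsilon> * y \<epsilon>) (\<lambda>\<epsilon>. x' \<epsilon> * y' \<epsilon>)"
    using * by (auto simp: gen_real_rel_def moderate_mult algebra_simps)
qed

definition minus_gen_real :: "gen_real \<Rightarrow> gen_real \<Rightarrow> gen_real" where
  "minus_gen_real x y = x + - y"

instance
proof
  fix a b c :: gen_real
  show "a * b * c = a * (b * c)"
    by transfer (simp add: gen_real_rel_def moderate_mult negligible_net_zero algebra_simps)
  show "a * b = b * a"
    by transfer (simp add: gen_real_rel_def moderate_mult negligible_net_zero algebra_simps)
  show "1 * a = a"
    by transfer (simp add: gen_real_rel_def negligible_net_zero)
  show "a + b + c = a + (b + c)"
    by transfer (simp add: gen_real_rel_def moderate_add negligible_net_zero algebra_simps)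
  show "a + b = b + a"
    by transfer (simp add: gen_real_rel_def moderate_add negligible_net_zero algebra_simps)
  show "0 + a = a"
    by transfer (simp add: gen_real_rel_def negligible_net_zero)
  show "- a + a = 0"
    by transfer (simp add: gen_real_rel_def moderate_const negligible_net_zero)
  show "a - b = a + - b"
    by (rule minus_gen_real_def)
  show "(a + b) * c = a * c + b * c"
    by transfer (simp add: gen_real_rel_def moderate_add moderate_mult negligible_net_zero algebra_simps)
  show "(0::gen_real) \<noteq> 1"
    by transfer (use negligible_net_uminus[of "\<lambda>_. - 1"] negligible_net_one in
        \<open>auto simp: gen_real_rel_def\<close>)
qed

end

definition gen_real_reps :: "gen_real \<Rightarrow> (real \<Rightarrow> real) set" where
  "gen_real_reps s = {r. moderate r \<and> abs_gen_real r = s}"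

instantiation gen_real :: order
begin

definition less_eq_gen_real :: "gen_real \<Rightarrow> gen_real \<Rightarrow> bool" where
  "x \<le> y \<longleftrightarrow> (\<exists>r \<in> gen_real_reps (y - x). \<forall>\<epsilon>\<in>{0<..1}. 0 \<le> r \<epsilon>)"

definition less_gen_real :: "gen_real \<Rightarrow> gen_real \<Rightarrow> bool" where
  "less_gen_real x y \<longleftrightarrow> x \<le> y \<and> \<not> y \<le> x"

lemma abs_gen_real_eq_iff:
  "moderate x \<Longrightarrow> moderate y \<Longrightarrow> abs_gen_real x = abs_gen_real y \<longleftrightarrow> gen_real_rel x y"
  using Quotient3_rel[OF Quotient3_gen_real, of x y]
  by (auto simp: gen_real_rel_def negligible_net_zero)

lemma abs_gen_real_plus:
  "moderate x \<Longrightarrow> moderate y \<Longrightarrow> abs_gen_real x + abs_gen_real y = abs_gen_real (\<lambda>\<epsilon>. x \<epsilon> + y \<epsilon>)"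
  by (rule plus_gen_real.abs_eq) (auto simp: gen_real_rel_def negligible_net_zero)

instance
proof
  fix x y z :: gen_real
  show "(x < y) = (x \<le> y \<and> \<not> y \<le> x)" by (rule less_gen_real_def)
  show "x \<le> x"
    unfolding less_eq_gen_real_def gen_real_reps_def
    by (rule bexI[where x = "\<lambda>_. 0"]) (auto simp: moderate_const zero_gen_real.abs_eq)
  show "x \<le> z" if xy: "x \<le> y" and yz: "y \<le> z"
  proof -
    obtain p q where "moderate p" "abs_gen_real p = y - x" "\<forall>\<epsilon>\<in>{0<..1}. 0 \<le> p \<epsilon>"
      "moderate q" "abs_gen_real q = z - y" "\<forall>\<epsilon>\<in>{0<..1}. 0 \<le> q \<epsilon>"
      using xy yz unfolding less_eq_gen_real_def gen_real_reps_def by blast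
    then show ?thesis
      unfolding less_eq_gen_real_def gen_real_reps_def
      by (intro bexI[where x = "\<lambda>\<epsilon>. p \<epsilon> + q \<epsilon>"])
         (auto simp: moderate_add abs_gen_real_plus[symmetric])
  qed
  show "x = y" if xy: "x \<le> y" and yx: "y \<le> x"
  proof -
    obtain p q where p: "moderate p" "abs_gen_real p = y - x" "\<forall>\<epsilon>\<in>{0<..1}. 0 \<le> p \<epsilon>"
      and q: "moderate q" "abs_gen_real q = x - y" "\<forall>\<epsilon>\<in>{0<..1}. 0 \<le> q \<epsilon>"
      using xy yx unfolding less_eq_gen_real_def gen_real_reps_def by blast
    have "abs_gen_real (\<lambda>\<epsilon>. p \<epsilon> + q \<epsilon>) = abs_gen_real (\<lambda>_. 0)"
      using p q by (simp add: abs_gen_real_plus[symmetric] zero_gen_real.abs_eq[symmetric])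
    then have n: "negligible_net (\<lambda>\<epsilon>. p \<epsilon> + q \<epsilon>)"
      using p(1) q(1) by (simp add: abs_gen_real_eq_iff moderate_add moderate_const gen_real_rel_def)
    have ev: "eventually (\<lambda>\<epsilon>::real. \<epsilon> \<in> {0<..<1}) (at_right 0)"
      by (rule eventually_at_right_real) simp
    have "p \<in> O[at_right 0](\<lambda>\<epsilon>. p \<epsilon> + q \<epsilon>)"
    proof (rule bigoI[where c = 1])
      show "\<forall>\<^sub>F \<epsilon> in at_right 0. norm (p \<epsilon>) \<le> 1 * norm (p \<epsilon> + q \<epsilon>)"
        using ev by eventually_elim (use p(3) q(3) in \<open>force simp: abs_if\<close>)
    qed
    then have "negligible_net p"
      using n landau_o.big_trans[of p] unfolding negligible_net_def by blast
    then have "abs_gen_real p = abs_gen_real (\<lambda>_. 0)"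
      using p(1) by (simp add: abs_gen_real_eq_iff moderate_const gen_real_rel_def)
    then show ?thesis using p(2) by (simp add: zero_gen_real.abs_eq[symmetric])
  qed
qed

end

section \<open>Smooth functions on an open set or its closure\<close>

text \<open>
  A list of basis vectors encodes a multi-index: the directions in which to differentiate. For
  smooth functions the order of the directions is immaterial, so that ranging over all lists
  amounts to ranging over all multi-indices.
\<close>

primrec iter_pderiv :: "'a::euclidean_space list \<Rightarrow> ('a \<Rightarrow> real) \<Rightarrow> 'a \<Rightarrow> real" where
  "iter_pderiv [] f = f"
| "iter_pderiv (b # \<alpha>) f = (\<lambda>x. deriv (\<lambda>t. iter_pderiv \<alpha> f (x + t *\<^sub>R b)) 0)"

text \<open>
  In the following, \<open>\<Omega>\<close> is open and \<open>D\<close> is \<open>\<Omega>\<close> or \<open>closure \<Omega>\<close>. Both sets are carried along, since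
  \<open>\<Omega>\<close> cannot be recovered from its closure, and the space of smooth functions on the closure
  depends on it.
\<close>

definition smooth_fun :: "'a::euclidean_space set \<Rightarrow> 'a set \<Rightarrow> ('a \<Rightarrow> real) \<Rightarrow> bool" where
  "smooth_fun \<Omega> D f \<longleftrightarrow>
     continuous_on D f \<and>
     (\<forall>\<alpha> \<in> lists Basis.
        (\<forall>x\<in>\<Omega>. \<forall>b\<in>Basis. (\<lambda>t. iter_pderiv \<alpha> f (x + t *\<^sub>R b)) field_differentiable (at 0)) \<and>
        (\<exists>h. continuous_on D h \<and> (\<forall>x\<in>\<Omega>. h x = iter_pderiv \<alpha> f x)))"

text \<open>
  The partial derivative on \<open>D\<close>: at points of \<open>D - \<Omega>\<close> it is the value of the continuous extension,
  i.e. the limit from inside \<open>\<Omega>\<close>.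
\<close>

definition pderiv_on :: "'a::euclidean_space set \<Rightarrow> 'a list \<Rightarrow> ('a \<Rightarrow> real) \<Rightarrow> 'a \<Rightarrow> real" where
  "pderiv_on \<Omega> \<alpha> f x =
     (if x \<in> \<Omega> then iter_pderiv \<alpha> f x else Lim (at x within \<Omega>) (iter_pderiv \<alpha> f))"

section \<open>Colombeau algebras\<close>

definition smooth_nets :: "'a::euclidean_space set \<Rightarrow> 'a set \<Rightarrow> (real \<Rightarrow> 'a \<Rightarrow> real) set" where
  "smooth_nets \<Omega> D = {u. \<forall>\<epsilon>\<in>{0<..1}. smooth_fun \<Omega> D (u \<epsilon>)}"

text \<open>The empty compact set is excluded because the supremum of the empty set of reals is a junk value.\<close>

definition moderate_nets :: "'a::euclidean_space set \<Rightarrow> 'a set \<Rightarrow> (real \<Rightarrow> 'a \<Rightarrow> real) set" where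
  "moderate_nets \<Omega> D = {u \<in> smooth_nets \<Omega> D.
     \<forall>K. compact K \<and> K \<subseteq> D \<and> K \<noteq> {} \<longrightarrow> (\<forall>\<alpha> \<in> lists Basis. \<exists>N::nat.
       (\<lambda>\<epsilon>. SUP x\<in>K. \<bar>pderiv_on \<Omega> \<alpha> (u \<epsilon>) x\<bar>) \<in> O[at_right 0](\<lambda>\<epsilon>. inverse \<epsilon> ^ N))}"

definition negligible_nets :: "'a::euclidean_space set \<Rightarrow> 'a set \<Rightarrow> (real \<Rightarrow> 'a \<Rightarrow> real) set" where
  "negligible_nets \<Omega> D = {u \<in> smooth_nets \<Omega> D.
     \<forall>K. compact K \<and> K \<subseteq> D \<and> K \<noteq> {} \<longrightarrow> (\<forall>\<alpha> \<in> lists Basis. \<forall>m::nat.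
       (\<lambda>\<epsilon>. SUP x\<in>K. \<bar>pderiv_on \<Omega> \<alpha> (u \<epsilon>) x\<bar>) \<in> O[at_right 0](\<lambda>\<epsilon>. \<epsilon> ^ m))}"

definition colombeau_rel ::
  "'a::euclidean_space set \<Rightarrow> 'a set \<Rightarrow> ((real \<Rightarrow> 'a \<Rightarrow> real) \<times> (real \<Rightarrow> 'a \<Rightarrow> real)) set" where
  "colombeau_rel \<Omega> D = {(u, v). u \<in> moderate_nets \<Omega> D \<and> v \<in> moderate_nets \<Omega> D \<and>
     (\<lambda>\<epsilon> x. u \<epsilon> x - v \<epsilon> x) \<in> negligible_nets \<Omega> D}"

type_synonym 'a gen_fun = "(real \<Rightarrow> 'a \<Rightarrow> real) set"

definition colombeau :: "'a::euclidean_space set \<Rightarrow> 'a set \<Rightarrow> 'a gen_fun set" where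
  "colombeau \<Omega> D = moderate_nets \<Omega> D // colombeau_rel \<Omega> D"

definition gf_zero :: "'a::euclidean_space set \<Rightarrow> 'a set \<Rightarrow> 'a gen_fun" where
  "gf_zero \<Omega> D = colombeau_rel \<Omega> D `` {\<lambda>\<epsilon> x. 0}"

definition gf_add ::
  "'a::euclidean_space set \<Rightarrow> 'a set \<Rightarrow> 'a gen_fun \<Rightarrow> 'a gen_fun \<Rightarrow> 'a gen_fun" where
  "gf_add \<Omega> D U V = colombeau_rel \<Omega> D `` {\<lambda>\<epsilon> x. u \<epsilon> x + v \<epsilon> x | u v. u \<in> U \<and> v \<in> V}"

definition gf_scale ::
  "'a::euclidean_space set \<Rightarrow> 'a set \<Rightarrow> gen_real \<Rightarrow> 'a gen_fun \<Rightarrow> 'a gen_fun" where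
  "gf_scale \<Omega> D s V =
     colombeau_rel \<Omega> D `` {\<lambda>\<epsilon> x. r \<epsilon> * v \<epsilon> x | r v. r \<in> gen_real_reps s \<and> v \<in> V}"

definition gf_pderiv ::
  "'a::euclidean_space set \<Rightarrow> 'a set \<Rightarrow> 'a list \<Rightarrow> 'a gen_fun \<Rightarrow> 'a gen_fun" where
  "gf_pderiv \<Omega> D \<alpha> U = colombeau_rel \<Omega> D `` {\<lambda>\<epsilon>. pderiv_on \<Omega> \<alpha> (u \<epsilon>) | u. u \<in> U}"

definition gf_submodule :: "'a::euclidean_space set \<Rightarrow> 'a set \<Rightarrow> 'a gen_fun set \<Rightarrow> bool" where
  "gf_submodule \<Omega> D M \<longleftrightarrow>
     M \<subseteq> colombeau \<Omega> D \<and> gf_zero \<Omega> D \<in> M \<and>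
     (\<forall>u\<in>M. \<forall>v\<in>M. gf_add \<Omega> D u v \<in> M) \<and> (\<forall>s. \<forall>v\<in>M. gf_scale \<Omega> D s v \<in> M)"

section \<open>Point values on an open interval\<close>

definition compact_nets :: "real set \<Rightarrow> (real \<Rightarrow> real) set" where
  "compact_nets J = {r. (\<forall>\<epsilon>\<in>{0<..1}. r \<epsilon> \<in> J) \<and>
     (\<exists>K. compact K \<and> K \<subseteq> J \<and> (\<forall>\<^sub>F \<epsilon> in at_right 0. r \<epsilon> \<in> K))}"

definition compact_points :: "real set \<Rightarrow> gen_real set" where
  "compact_points J = abs_gen_real ` compact_nets J"

definition point_value :: "real set \<Rightarrow> real gen_fun \<Rightarrow> gen_real \<Rightarrow> gen_real" where
  "point_value J g s =
     (THE y. \<exists>f\<in>g. \<exists>r \<in> compact_nets J \<inter> gen_real_reps s. y = abs_gen_real (\<lambda>\<epsilon>. f \<epsilon> (r \<epsilon>)))"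

definition has_point_values :: "real set \<Rightarrow> (gen_real \<Rightarrow> gen_real) \<Rightarrow> real gen_fun \<Rightarrow> bool" where
  "has_point_values J F g \<longleftrightarrow>
     g \<in> colombeau J J \<and> (\<forall>s \<in> compact_points J. point_value J g s = F s)"

text \<open>
  For an open interval \<open>J\<close> around \<open>0\<close>, \<open>deriv_at_zero J k F\<close> is the \<open>k\<close>-th derivative at \<open>0\<close> of the
  element of \<open>colombeau J J\<close> whose point values are given by \<open>F\<close>. This element is unique, so that
  the choice operator is harmless.
\<close>

definition deriv_at_zero :: "real set \<Rightarrow> nat \<Rightarrow> (gen_real \<Rightarrow> gen_real) \<Rightarrow> gen_real" where
  "deriv_at_zero J k F =
     point_value J (gf_pderiv J J (replicate k 1) (SOME g. has_point_values J F g)) 0"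

section \<open>First and second variation\<close>

definition along_line ::
  "'a::euclidean_space set \<Rightarrow> 'a set \<Rightarrow> ('a gen_fun \<Rightarrow> gen_real) \<Rightarrow> 'a gen_fun \<Rightarrow> 'a gen_fun
     \<Rightarrow> gen_real \<Rightarrow> gen_real" where
  "along_line \<Omega> D L u v s = L (gf_add \<Omega> D u (gf_scale \<Omega> D s v))"

definition first_variation ::
  "'a::euclidean_space set \<Rightarrow> 'a set \<Rightarrow> real set \<Rightarrow> ('a gen_fun \<Rightarrow> gen_real) \<Rightarrow> 'a gen_fun
     \<Rightarrow> 'a gen_fun \<Rightarrow> gen_real" where
  "first_variation \<Omega> D J L u v = deriv_at_zero J 1 (along_line \<Omega> D L u v)"

definition second_variation ::
  "'a::euclidean_space set \<Rightarrow> 'a set \<Rightarrow> real set \<Rightarrow> ('a gen_fun \<Rightarrow> gen_real) \<Rightarrow> 'a gen_fun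
     \<Rightarrow> 'a gen_fun \<Rightarrow> gen_real" where
  "second_variation \<Omega> D J L u v = deriv_at_zero J 2 (along_line \<Omega> D L u v)"

end

theory Submission
  imports Defs
begin

text \<open>
  Fix \<open>u\<close> and \<open>v\<close> and write \<open>F s = L (u + s v)\<close>, represented by a net \<open>f\<close> of smooth functions on the
  interval \<open>J\<close>. Since \<open>u + s v\<close> is a competitor for every generalized number \<open>s\<close>, minimality says
  \<open>F 0 \<le> F s\<close> at every compactly supported generalized point, provided that \<open>F 0 = L u\<close>, that is
  \<open>u + 0 v = u\<close> in the quotient algebra (\<open>gf_add_scale_0\<close>).

  The classical argument with a fixed step would only bound the derivatives up to a standard error,
  whereas equality and positivity of generalized numbers are statements up to \<open>\<epsilon>\<^sup>m\<close> for all \<open>m\<close>.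
  The freedom to use \<^emph>\<open>generalized\<close> steps closes this gap. On a fixed compact interval each derivative
  of \<open>f\<close> is bounded by some \<open>\<epsilon>\<close> to the power \<open>-N\<close>, so with step \<open>h = \<epsilon>\<^sup>k\<close> the Taylor remainder of order
  \<open>n\<close> is at most \<open>h\<close> to the power \<open>n\<close>, divided by \<open>\<epsilon>\<close> to the power \<open>N\<close>. Taking \<open>k > N + m\<close> makes it smaller
  than \<open>h\<close> to the power \<open>n - 1\<close> by a factor \<open>\<epsilon>\<^sup>m\<close>.

  Order one (\<open>negligible_first_derivative\<close>): step against the sign of the derivative \<open>b\<close>, a net of
  signs depending on \<open>\<epsilon>\<close>, so that the increment is \<open>-\<bar>b\<bar> h\<close> up to the remainder; as it is
  nonnegative up to a negligible error, \<open>\<bar>b\<bar>\<close> is of order \<open>\<epsilon>\<^sup>m\<close>. Order two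
  (\<open>nonneg_second_derivative\<close>): now \<open>b\<close> is negligible, hence so is \<open>b h\<close> compared with \<open>h\<^sup>2\<close>, and the
  quadratic term dominates.

  To apply this to the classes, point values must be computable from any representative of the
  function and of the point (\<open>point_value_eq\<close>), and differentiation must descend to the quotient
  (\<open>gf_pderiv_class\<close>). Both rest on the linearity of the partial derivatives, including their
  continuous extensions to the boundary.
\<close>

section \<open>Generalized reals through eventual estimates\<close>

lemma eventually_small: "\<forall>\<^sub>F \<epsilon>::real in at_right 0. 0 < \<epsilon> \<and> \<epsilon> < 1"
  using eventually_at_right_real[of 0 "1::real"] by simp

text \<open>
  Exponents absorb constants: trading one power of \<open>\<epsilon>\<close> for the constant of a Landau bound leaves
  plain inequalities, which can be combined under \<open>eventually\<close>.
\<close>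

lemma bigo_power_imp_le:
  assumes "x \<in> O[at_right 0](\<lambda>\<epsilon>::real. \<epsilon> ^ Suc m)"
  shows "\<forall>\<^sub>F \<epsilon> in at_right 0. \<bar>x \<epsilon> :: real\<bar> \<le> \<epsilon> ^ m"
proof -
  from assms obtain c where c: "c > 0" "\<forall>\<^sub>F \<epsilon> in at_right 0. norm (x \<epsilon>) \<le> c * norm (\<epsilon> ^ Suc m)"
    by (elim landau_o.bigE)
  have "\<forall>\<^sub>F \<epsilon>::real in at_right 0. \<epsilon> \<in> {0<..<1 / c}"
    using c(1) by (intro eventually_at_right_real) simp
  with c(2) show ?thesis
  proof eventually_elim
    case (elim \<epsilon>)
    then have "c * \<epsilon> \<le> 1" using c(1) by (simp add: field_simps)
    then have "c * \<epsilon> * \<epsilon> ^ m \<le> 1 * \<epsilon> ^ m" using elim by (intro mult_right_mono) auto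
    moreover have "norm (\<epsilon> ^ Suc m) = \<epsilon> * \<epsilon> ^ m" using elim by simp
    ultimately show ?case using elim by (simp only: real_norm_def mult.assoc mult_1)
  qed
qed

lemma bigo_inverse_power_imp_le:
  assumes "x \<in> O[at_right 0](\<lambda>\<epsilon>::real. inverse \<epsilon> ^ N)"
  shows "\<forall>\<^sub>F \<epsilon> in at_right 0. \<bar>x \<epsilon> :: real\<bar> \<le> inverse \<epsilon> ^ Suc N"
proof -
  from assms obtain c where c: "c > 0" "\<forall>\<^sub>F \<epsilon> in at_right 0. norm (x \<epsilon>) \<le> c * norm (inverse \<epsilon> ^ N)"
    by (elim landau_o.bigE)
  have "\<forall>\<^sub>F \<epsilon>::real in at_right 0. \<epsilon> \<in> {0<..<1 / c}"
    using c(1) by (intro eventually_at_right_real) simp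
  with c(2) show ?thesis
  proof eventually_elim
    case (elim \<epsilon>)
    then have "c \<le> inverse \<epsilon>" using c(1) by (simp add: field_simps)
    then have "c * inverse \<epsilon> ^ N \<le> inverse \<epsilon> * inverse \<epsilon> ^ N" using elim by (intro mult_right_mono) auto
    moreover have "norm (inverse \<epsilon> ^ N) = inverse \<epsilon> ^ N" using elim by simp
    ultimately show ?case using elim by (simp only: real_norm_def power_Suc)
  qed
qed

lemma moderate_iff: "moderate x \<longleftrightarrow> (\<exists>N. \<forall>\<^sub>F \<epsilon> in at_right 0. \<bar>x \<epsilon>\<bar> \<le> inverse \<epsilon> ^ N)"
proof
  assume "moderate x"
  then show "\<exists>N. \<forall>\<^sub>F \<epsilon> in at_right 0. \<bar>x \<epsilon>\<bar> \<le> inverse \<epsilon> ^ N"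
    unfolding moderate_def using bigo_inverse_power_imp_le by blast
next
  assume "\<exists>N. \<forall>\<^sub>F \<epsilon> in at_right 0. \<bar>x \<epsilon>\<bar> \<le> inverse \<epsilon> ^ N"
  then obtain N where "\<forall>\<^sub>F \<epsilon> in at_right 0. \<bar>x \<epsilon>\<bar> \<le> inverse \<epsilon> ^ N" ..
  then have "x \<in> O[at_right 0](\<lambda>\<epsilon>. inverse \<epsilon> ^ N)"
    by (intro bigoI[where c = 1], elim eventually_mono) (auto intro: order_trans)
  then show "moderate x" unfolding moderate_def by blast
qed

lemma negligible_netD: "negligible_net x \<Longrightarrow> \<forall>\<^sub>F \<epsilon> in at_right 0. \<bar>x \<epsilon>\<bar> \<le> \<epsilon> ^ m"
  unfolding negligible_net_def using bigo_power_imp_le by blast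

lemma negligible_netI:
  assumes "\<And>m. \<forall>\<^sub>F \<epsilon> in at_right 0. \<bar>x \<epsilon>\<bar> \<le> C * \<epsilon> ^ m"
  shows "negligible_net x"
  unfolding negligible_net_def
proof
  fix m :: nat
  show "x \<in> O[at_right 0](\<lambda>\<epsilon>. \<epsilon> ^ m)"
  proof (rule bigoI[where c = C])
    show "\<forall>\<^sub>F \<epsilon> in at_right 0. norm (x \<epsilon>) \<le> C * norm (\<epsilon> ^ m)"
      using assms[of m] eventually_small by eventually_elim auto
  qed
qed

lemma negligible_net_iff: "negligible_net x \<longleftrightarrow> (\<forall>m. \<forall>\<^sub>F \<epsilon> in at_right 0. \<bar>x \<epsilon>\<bar> \<le> \<epsilon> ^ m)"
  using negligible_netD negligible_netI[of x 1] by auto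

lemma negligible_imp_moderate: "negligible_net x \<Longrightarrow> moderate x"
  unfolding moderate_iff by (rule exI[of _ 0]) (use negligible_netD[of x 0] in simp)

lemma moderate_diff: "moderate x \<Longrightarrow> moderate y \<Longrightarrow> moderate (\<lambda>\<epsilon>. x \<epsilon> - y \<epsilon>)"
  using moderate_add[OF _ moderate_uminus] by fastforce

lemma abs_gen_real_diff:
  assumes "moderate x" "moderate y"
  shows "abs_gen_real x - abs_gen_real y = abs_gen_real (\<lambda>\<epsilon>. x \<epsilon> - y \<epsilon>)"
  using abs_gen_real_plus[OF moderate_diff[OF assms] assms(2)] by (simp add: algebra_simps)

lemma abs_gen_real_eq_0_iff: "moderate x \<Longrightarrow> abs_gen_real x = 0 \<longleftrightarrow> negligible_net x"
  by (simp add: zero_gen_real.abs_eq abs_gen_real_eq_iff moderate_const gen_real_rel_def)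

text \<open>
  Some representative is nonnegative, so an arbitrary one is nonnegative up to a negligible net. Together
  with the converse below, this turns the order into estimates that do not mention representatives.
\<close>

lemma abs_gen_real_nonnegD:
  assumes "moderate x" "0 \<le> abs_gen_real x"
  shows "\<forall>\<^sub>F \<epsilon> in at_right 0. - (\<epsilon> ^ m) \<le> x \<epsilon>"
proof -
  from assms(2) obtain r where r: "moderate r" "abs_gen_real r = abs_gen_real x" "\<forall>\<epsilon>\<in>{0<..1}. 0 \<le> r \<epsilon>"
    unfolding less_eq_gen_real_def gen_real_reps_def by auto
  then have "negligible_net (\<lambda>\<epsilon>. r \<epsilon> - x \<epsilon>)"
    using assms(1) by (simp add: abs_gen_real_eq_iff gen_real_rel_def)
  from negligible_netD[OF this, of m] eventually_small show ?thesis
  proof eventually_elim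
    case (elim \<epsilon>)
    then have "0 \<le> r \<epsilon>" using r(3) by auto
    then show ?case using elim by linarith
  qed
qed

text \<open>The positive part is the nonnegative representative; it differs from the net by its negative part.\<close>

lemma abs_gen_real_nonnegI:
  assumes "moderate x" "\<And>m. \<forall>\<^sub>F \<epsilon> in at_right 0. - (C * \<epsilon> ^ m) \<le> x \<epsilon>" "0 \<le> C"
  shows "0 \<le> abs_gen_real x"
proof -
  let ?r = "\<lambda>\<epsilon>. max (x \<epsilon>) 0"
  have "negligible_net (\<lambda>\<epsilon>. ?r \<epsilon> - x \<epsilon>)"
  proof (rule negligible_netI)
    fix m
    show "\<forall>\<^sub>F \<epsilon> in at_right 0. \<bar>?r \<epsilon> - x \<epsilon>\<bar> \<le> C * \<epsilon> ^ m"
      using assms(2)[of m] eventually_small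
    proof eventually_elim
      case (elim \<epsilon>)
      have "0 \<le> C * \<epsilon> ^ m" using elim assms(3) by auto
      then show ?case using elim by (auto simp: max_def)
    qed
  qed
  moreover have "moderate ?r"
    using moderate_add[OF negligible_imp_moderate[OF calculation] assms(1)] by simp
  ultimately have "?r \<in> gen_real_reps (abs_gen_real x - 0)"
    using assms(1) by (simp add: gen_real_reps_def abs_gen_real_eq_iff gen_real_rel_def)
  then show ?thesis
    unfolding less_eq_gen_real_def by (rule rev_bexI) simp
qed

section \<open>Partial derivatives on an open set or its closure\<close>

text \<open>
  The common core of the two cases \<open>D = \<Omega>\<close> and \<open>D = closure \<Omega>\<close>: as \<open>\<Omega>\<close> is dense in \<open>D\<close>, a continuous
  function on \<open>D\<close> is determined by its values on \<open>\<Omega>\<close>.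
\<close>

locale smooth_domain =
  fixes \<Omega> D :: "'a::euclidean_space set"
  assumes open_dom: "open \<Omega>" and dom_subset: "\<Omega> \<subseteq> D" and subset_closure: "D \<subseteq> closure \<Omega>"
begin

lemma eventually_in_dom:
  assumes "x \<in> \<Omega>" shows "\<forall>\<^sub>F t in nhds 0. x + t *\<^sub>R b \<in> \<Omega>"
proof -
  have "((\<lambda>t. x + t *\<^sub>R b) \<longlongrightarrow> x + 0 *\<^sub>R b) (nhds 0)" by (intro tendsto_intros filterlim_ident)
  then show ?thesis using assms open_dom by (simp add: topological_tendstoD)
qed

lemma smooth_fun_has_derivative:
  assumes "smooth_fun \<Omega> D f" "\<alpha> \<in> lists Basis" "b \<in> Basis" "x \<in> \<Omega>"
  shows "((\<lambda>t. iter_pderiv \<alpha> f (x + t *\<^sub>R b)) has_field_derivative iter_pderiv (b # \<alpha>) f x) (at 0)"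
  using assms unfolding smooth_fun_def by (simp add: DERIV_deriv_iff_field_differentiable)

text \<open>
  An iterated derivative is only meaningful inside \<open>\<Omega>\<close>, so identities between functions on \<open>\<Omega>\<close> have
  to be transported through \<open>deriv\<close> by openness.
\<close>

lemma has_derivative_transfer:
  assumes "\<And>y. y \<in> \<Omega> \<Longrightarrow> f y = h y" "x \<in> \<Omega>"
    and "((\<lambda>t. h (x + t *\<^sub>R b)) has_field_derivative d) (at 0)"
  shows "((\<lambda>t. f (x + t *\<^sub>R b)) has_field_derivative d) (at 0)"
proof -
  have "\<forall>\<^sub>F t in nhds 0. f (x + t *\<^sub>R b) = h (x + t *\<^sub>R b)"
    using eventually_in_dom[OF assms(2), of b] by eventually_elim (rule assms(1))
  from DERIV_cong_ev[OF refl this refl] assms(3) show ?thesis by simp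
qed

lemma iter_pderiv_lincomb:
  assumes f: "smooth_fun \<Omega> D f" and g: "smooth_fun \<Omega> D g" and "\<alpha> \<in> lists Basis" "x \<in> \<Omega>"
  shows "iter_pderiv \<alpha> (\<lambda>y. f y + c * g y) x = iter_pderiv \<alpha> f x + c * iter_pderiv \<alpha> g x"
  using assms(3,4)
proof (induction \<alpha> arbitrary: x rule: list.induct)
  case (Cons b \<alpha>)
  have b: "b \<in> Basis" and \<alpha>: "\<alpha> \<in> lists Basis" and x: "x \<in> \<Omega>"
    using Cons.prems by auto
  have "((\<lambda>t. iter_pderiv \<alpha> f (x + t *\<^sub>R b) + c * iter_pderiv \<alpha> g (x + t *\<^sub>R b)) has_field_derivative
      iter_pderiv (b # \<alpha>) f x + c * iter_pderiv (b # \<alpha>) g x) (at 0)"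
    by (intro DERIV_add DERIV_cmult smooth_fun_has_derivative f g b \<alpha> x)
  then have "((\<lambda>t. iter_pderiv \<alpha> (\<lambda>y. f y + c * g y) (x + t *\<^sub>R b)) has_field_derivative
      iter_pderiv (b # \<alpha>) f x + c * iter_pderiv (b # \<alpha>) g x) (at 0)"
    by (rule has_derivative_transfer[rotated 2]) (use Cons.IH \<alpha> x in auto)
  then show ?case by (simp add: DERIV_imp_deriv)
qed simp

lemma smooth_fun_lincomb:
  assumes f: "smooth_fun \<Omega> D f" and g: "smooth_fun \<Omega> D g"
  shows "smooth_fun \<Omega> D (\<lambda>y. f y + c * g y)"
  unfolding smooth_fun_def
proof (intro conjI ballI)
  show "continuous_on D (\<lambda>y. f y + c * g y)"
    using f g by (auto simp: smooth_fun_def intro!: continuous_intros)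
next
  fix \<alpha> :: "'a list" and x b :: 'a assume *: "\<alpha> \<in> lists Basis" "x \<in> \<Omega>" "b \<in> Basis"
  have "((\<lambda>t. iter_pderiv \<alpha> f (x + t *\<^sub>R b) + c * iter_pderiv \<alpha> g (x + t *\<^sub>R b)) has_field_derivative
      iter_pderiv (b # \<alpha>) f x + c * iter_pderiv (b # \<alpha>) g x) (at 0)"
    using * by (intro DERIV_add DERIV_cmult smooth_fun_has_derivative f g) auto
  then have "((\<lambda>t. iter_pderiv \<alpha> (\<lambda>y. f y + c * g y) (x + t *\<^sub>R b)) has_field_derivative
      iter_pderiv (b # \<alpha>) f x + c * iter_pderiv (b # \<alpha>) g x) (at 0)"
    by (rule has_derivative_transfer[rotated 2]) (use * iter_pderiv_lincomb[OF f g] in auto)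
  then show "(\<lambda>t. iter_pderiv \<alpha> (\<lambda>y. f y + c * g y) (x + t *\<^sub>R b)) field_differentiable (at 0)"
    unfolding field_differentiable_def by blast
next
  fix \<alpha> :: "'a list" assume *: "\<alpha> \<in> lists Basis"
  obtain h1 h2 where "continuous_on D h1" "\<forall>x\<in>\<Omega>. h1 x = iter_pderiv \<alpha> f x"
    "continuous_on D h2" "\<forall>x\<in>\<Omega>. h2 x = iter_pderiv \<alpha> g x"
    using f g * unfolding smooth_fun_def by metis
  then show "\<exists>h. continuous_on D h \<and> (\<forall>x\<in>\<Omega>. h x = iter_pderiv \<alpha> (\<lambda>y. f y + c * g y) x)"
    using * by (intro exI[of _ "\<lambda>x. h1 x + c * h2 x"])
      (auto simp: iter_pderiv_lincomb[OF f g] intro!: continuous_intros)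
qed

lemma not_trivial_limit_boundary:
  assumes "x \<in> D" "x \<notin> \<Omega>" shows "at x within \<Omega> \<noteq> bot"
  using assms subset_closure by (auto simp: closure_def trivial_limit_within)

lemma pderiv_on_interior: "x \<in> \<Omega> \<Longrightarrow> pderiv_on \<Omega> \<alpha> f x = iter_pderiv \<alpha> f x"
  by (simp add: pderiv_on_def)

text \<open>
  This replaces the limits in \<open>pderiv_on\<close> by any known continuous extension, which reduces
  identities on \<open>D\<close> to identities on \<open>\<Omega>\<close>.
\<close>

lemma pderiv_on_eq_extension:
  assumes "continuous_on D h" "\<And>x. x \<in> \<Omega> \<Longrightarrow> h x = iter_pderiv \<alpha> f x" "x \<in> D"
  shows "pderiv_on \<Omega> \<alpha> f x = h x"
proof (cases "x \<in> \<Omega>")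
  case False
  have "(h \<longlongrightarrow> h x) (at x within \<Omega>)"
    using assms(1,3) dom_subset tendsto_within_subset unfolding continuous_on_def by blast
  moreover have "\<forall>\<^sub>F y in at x within \<Omega>. h y = iter_pderiv \<alpha> f y"
    using assms(2) by (auto simp: eventually_at_filter)
  ultimately have "(iter_pderiv \<alpha> f \<longlongrightarrow> h x) (at x within \<Omega>)"
    using tendsto_cong by blast
  then show ?thesis
    using False tendsto_Lim[OF not_trivial_limit_boundary[OF assms(3) False]] by (simp add: pderiv_on_def)
qed (simp add: assms(2) pderiv_on_def)

lemma continuous_on_pderiv_on:
  assumes "smooth_fun \<Omega> D f" "\<alpha> \<in> lists Basis"
  shows "continuous_on D (pderiv_on \<Omega> \<alpha> f)"
proof -
  obtain h where "continuous_on D h" "\<forall>x\<in>\<Omega>. h x = iter_pderiv \<alpha> f x"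
    using assms unfolding smooth_fun_def by metis
  then show ?thesis using pderiv_on_eq_extension[of h \<alpha> f] continuous_on_cong[of D D h "pderiv_on \<Omega> \<alpha> f"] by auto
qed

lemma pderiv_on_lincomb:
  assumes "smooth_fun \<Omega> D f" "smooth_fun \<Omega> D g" "\<alpha> \<in> lists Basis" "x \<in> D"
  shows "pderiv_on \<Omega> \<alpha> (\<lambda>y. f y + c * g y) x = pderiv_on \<Omega> \<alpha> f x + c * pderiv_on \<Omega> \<alpha> g x"
proof (rule pderiv_on_eq_extension)
  show "continuous_on D (\<lambda>x. pderiv_on \<Omega> \<alpha> f x + c * pderiv_on \<Omega> \<alpha> g x)"
    using assms by (intro continuous_intros continuous_on_pderiv_on)
qed (use assms in \<open>auto simp: iter_pderiv_lincomb pderiv_on_interior\<close>)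

lemma iter_pderiv_pderiv_on:
  assumes "smooth_fun \<Omega> D f" "\<alpha> \<in> lists Basis" "\<beta> \<in> lists Basis" "x \<in> \<Omega>"
  shows "iter_pderiv \<beta> (pderiv_on \<Omega> \<alpha> f) x = iter_pderiv (\<beta> @ \<alpha>) f x"
  using assms(3,4)
proof (induction \<beta> arbitrary: x rule: list.induct)
  case (Cons b \<beta>)
  have "((\<lambda>t. iter_pderiv \<beta> (pderiv_on \<Omega> \<alpha> f) (x + t *\<^sub>R b)) has_field_derivative
      iter_pderiv (b # \<beta> @ \<alpha>) f x) (at 0)"
    by (rule has_derivative_transfer[OF _ _ smooth_fun_has_derivative]) (use Cons assms in auto)
  then show ?case by (simp add: DERIV_imp_deriv)
qed (simp add: pderiv_on_def)

lemma smooth_fun_pderiv_on: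
  assumes f: "smooth_fun \<Omega> D f" and \<alpha>: "\<alpha> \<in> lists Basis"
  shows "smooth_fun \<Omega> D (pderiv_on \<Omega> \<alpha> f)"
  unfolding smooth_fun_def
proof (intro conjI ballI)
  show "continuous_on D (pderiv_on \<Omega> \<alpha> f)" using assms by (rule continuous_on_pderiv_on)
next
  fix \<beta> :: "'a list" and x b :: 'a assume *: "\<beta> \<in> lists Basis" "x \<in> \<Omega>" "b \<in> Basis"
  have "((\<lambda>t. iter_pderiv \<beta> (pderiv_on \<Omega> \<alpha> f) (x + t *\<^sub>R b)) has_field_derivative
      iter_pderiv (b # \<beta> @ \<alpha>) f x) (at 0)"
    by (rule has_derivative_transfer[OF _ _ smooth_fun_has_derivative])
      (use * assms iter_pderiv_pderiv_on in auto)
  then show "(\<lambda>t. iter_pderiv \<beta> (pderiv_on \<Omega> \<alpha> f) (x + t *\<^sub>R b)) field_differentiable (at 0)"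
    unfolding field_differentiable_def by blast
next
  fix \<beta> :: "'a list" assume *: "\<beta> \<in> lists Basis"
  then show "\<exists>h. continuous_on D h \<and> (\<forall>x\<in>\<Omega>. h x = iter_pderiv \<beta> (pderiv_on \<Omega> \<alpha> f) x)"
    using assms by (intro exI[of _ "pderiv_on \<Omega> (\<beta> @ \<alpha>) f"])
      (auto simp: iter_pderiv_pderiv_on continuous_on_pderiv_on pderiv_on_interior)
qed

lemma pderiv_on_pderiv_on:
  assumes "smooth_fun \<Omega> D f" "\<alpha> \<in> lists Basis" "\<beta> \<in> lists Basis" "x \<in> D"
  shows "pderiv_on \<Omega> \<beta> (pderiv_on \<Omega> \<alpha> f) x = pderiv_on \<Omega> (\<beta> @ \<alpha>) f x"
  by (rule pderiv_on_eq_extension)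
    (use assms in \<open>auto simp: iter_pderiv_pderiv_on continuous_on_pderiv_on pderiv_on_interior\<close>)

section \<open>The Colombeau algebra as a quotient\<close>

text \<open>
  A supremum of reals is only informative when the set is bounded. Here it is, because the derivatives
  are continuous on \<open>D\<close>; this allows the suprema to be replaced by pointwise bounds.
\<close>

lemma SUP_abs_le_iff:
  assumes "smooth_fun \<Omega> D f" "\<alpha> \<in> lists Basis" "compact K" "K \<subseteq> D" "K \<noteq> {}"
  shows "\<bar>SUP x\<in>K. \<bar>pderiv_on \<Omega> \<alpha> f x\<bar>\<bar> \<le> B \<longleftrightarrow> (\<forall>x\<in>K. \<bar>pderiv_on \<Omega> \<alpha> f x\<bar> \<le> B)"
proof -
  have "compact ((\<lambda>x. \<bar>pderiv_on \<Omega> \<alpha> f x\<bar>) ` K)"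
    using continuous_on_subset[OF continuous_on_pderiv_on[OF assms(1,2)] assms(4)] assms(3)
    by (intro compact_continuous_image continuous_intros)
  then have bdd: "bdd_above ((\<lambda>x. \<bar>pderiv_on \<Omega> \<alpha> f x\<bar>) ` K)"
    by (simp add: compact_imp_bounded bounded_imp_bdd_above)
  have "0 \<le> (SUP x\<in>K. \<bar>pderiv_on \<Omega> \<alpha> f x\<bar>)"
    using assms(5) bdd by (meson abs_ge_zero cSUP_upper2 ex_in_conv)
  then show ?thesis by (simp add: cSUP_le_iff[OF assms(5) bdd])
qed

lemma eventually_SUP_abs_le_iff:
  assumes "u \<in> smooth_nets \<Omega> D" "\<alpha> \<in> lists Basis" "compact K" "K \<subseteq> D" "K \<noteq> {}"
  shows "(\<forall>\<^sub>F \<epsilon> in at_right 0. \<bar>SUP x\<in>K. \<bar>pderiv_on \<Omega> \<alpha> (u \<epsilon>) x\<bar>\<bar> \<le> B \<epsilon>) \<longleftrightarrow>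
    (\<forall>\<^sub>F \<epsilon> in at_right 0. \<forall>x\<in>K. \<bar>pderiv_on \<Omega> \<alpha> (u \<epsilon>) x\<bar> \<le> B \<epsilon>)"
  by (rule eventually_cong[OF eventually_small], rule SUP_abs_le_iff)
    (use assms in \<open>auto simp: smooth_nets_def\<close>)

lemma moderate_nets_iff:
  "u \<in> moderate_nets \<Omega> D \<longleftrightarrow> u \<in> smooth_nets \<Omega> D \<and>
    (\<forall>K \<alpha>. compact K \<longrightarrow> K \<subseteq> D \<longrightarrow> \<alpha> \<in> lists Basis \<longrightarrow>
      (\<exists>N. \<forall>\<^sub>F \<epsilon> in at_right 0. \<forall>x\<in>K. \<bar>pderiv_on \<Omega> \<alpha> (u \<epsilon>) x\<bar> \<le> inverse \<epsilon> ^ N))"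
proof (cases "u \<in> smooth_nets \<Omega> D")
  case True
  have "u \<in> moderate_nets \<Omega> D \<longleftrightarrow> (\<forall>K. compact K \<and> K \<subseteq> D \<and> K \<noteq> {} \<longrightarrow> (\<forall>\<alpha> \<in> lists Basis.
      moderate (\<lambda>\<epsilon>. SUP x\<in>K. \<bar>pderiv_on \<Omega> \<alpha> (u \<epsilon>) x\<bar>)))"
    using True by (simp add: moderate_nets_def moderate_def)
  also have "\<dots> \<longleftrightarrow> (\<forall>K. compact K \<and> K \<subseteq> D \<and> K \<noteq> {} \<longrightarrow> (\<forall>\<alpha> \<in> lists Basis.
      \<exists>N. \<forall>\<^sub>F \<epsilon> in at_right 0. \<forall>x\<in>K. \<bar>pderiv_on \<Omega> \<alpha> (u \<epsilon>) x\<bar> \<le> inverse \<epsilon> ^ N))"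
    unfolding moderate_iff using eventually_SUP_abs_le_iff[OF True] by simp
  also have "\<dots> \<longleftrightarrow> (\<forall>K \<alpha>. compact K \<longrightarrow> K \<subseteq> D \<longrightarrow> \<alpha> \<in> lists Basis \<longrightarrow>
      (\<exists>N. \<forall>\<^sub>F \<epsilon> in at_right 0. \<forall>x\<in>K. \<bar>pderiv_on \<Omega> \<alpha> (u \<epsilon>) x\<bar> \<le> inverse \<epsilon> ^ N))"
  proof (intro iffI allI ballI impI)
    fix K and \<alpha> :: "'a list" assume "\<forall>K. compact K \<and> K \<subseteq> D \<and> K \<noteq> {} \<longrightarrow> (\<forall>\<alpha> \<in> lists Basis.
      \<exists>N. \<forall>\<^sub>F \<epsilon> in at_right 0. \<forall>x\<in>K. \<bar>pderiv_on \<Omega> \<alpha> (u \<epsilon>) x\<bar> \<le> inverse \<epsilon> ^ N)" and K: "compact K" "K \<subseteq> D" "\<alpha> \<in> lists Basis"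
    then show "\<exists>N. \<forall>\<^sub>F \<epsilon> in at_right 0. \<forall>x\<in>K. \<bar>pderiv_on \<Omega> \<alpha> (u \<epsilon>) x\<bar> \<le> inverse \<epsilon> ^ N" by (cases "K = {}") auto
  qed blast
  finally show ?thesis using True by blast
qed (simp add: moderate_nets_def)

lemma negligible_nets_iff:
  "u \<in> negligible_nets \<Omega> D \<longleftrightarrow> u \<in> smooth_nets \<Omega> D \<and>
    (\<forall>K \<alpha> m. compact K \<longrightarrow> K \<subseteq> D \<longrightarrow> \<alpha> \<in> lists Basis \<longrightarrow>
      (\<forall>\<^sub>F \<epsilon> in at_right 0. \<forall>x\<in>K. \<bar>pderiv_on \<Omega> \<alpha> (u \<epsilon>) x\<bar> \<le> \<epsilon> ^ m))"
proof (cases "u \<in> smooth_nets \<Omega> D")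
  case True
  have "u \<in> negligible_nets \<Omega> D \<longleftrightarrow> (\<forall>K. compact K \<and> K \<subseteq> D \<and> K \<noteq> {} \<longrightarrow> (\<forall>\<alpha> \<in> lists Basis.
      negligible_net (\<lambda>\<epsilon>. SUP x\<in>K. \<bar>pderiv_on \<Omega> \<alpha> (u \<epsilon>) x\<bar>)))"
    using True by (simp add: negligible_nets_def negligible_net_def)
  also have "\<dots> \<longleftrightarrow> (\<forall>K. compact K \<and> K \<subseteq> D \<and> K \<noteq> {} \<longrightarrow> (\<forall>\<alpha> \<in> lists Basis.
      \<forall>m. \<forall>\<^sub>F \<epsilon> in at_right 0. \<forall>x\<in>K. \<bar>pderiv_on \<Omega> \<alpha> (u \<epsilon>) x\<bar> \<le> \<epsilon> ^ m))"
    unfolding negligible_net_iff using eventually_SUP_abs_le_iff[OF True] by simp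
  also have "\<dots> \<longleftrightarrow> (\<forall>K \<alpha> m. compact K \<longrightarrow> K \<subseteq> D \<longrightarrow> \<alpha> \<in> lists Basis \<longrightarrow>
      (\<forall>\<^sub>F \<epsilon> in at_right 0. \<forall>x\<in>K. \<bar>pderiv_on \<Omega> \<alpha> (u \<epsilon>) x\<bar> \<le> \<epsilon> ^ m))"
  proof (intro iffI allI ballI impI)
    fix K and \<alpha> :: "'a list" and m assume "\<forall>K. compact K \<and> K \<subseteq> D \<and> K \<noteq> {} \<longrightarrow> (\<forall>\<alpha> \<in> lists Basis.
      \<forall>m. \<forall>\<^sub>F \<epsilon> in at_right 0. \<forall>x\<in>K. \<bar>pderiv_on \<Omega> \<alpha> (u \<epsilon>) x\<bar> \<le> \<epsilon> ^ m)" and K: "compact K" "K \<subseteq> D" "\<alpha> \<in> lists Basis"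
    then show "\<forall>\<^sub>F \<epsilon> in at_right 0. \<forall>x\<in>K. \<bar>pderiv_on \<Omega> \<alpha> (u \<epsilon>) x\<bar> \<le> \<epsilon> ^ m" by (cases "K = {}") auto
  qed blast
  finally show ?thesis using True by blast
qed (simp add: negligible_nets_def)

lemma smooth_nets_lincomb:
  assumes "u \<in> smooth_nets \<Omega> D" "v \<in> smooth_nets \<Omega> D"
  shows "(\<lambda>\<epsilon> x. u \<epsilon> x + r \<epsilon> * v \<epsilon> x) \<in> smooth_nets \<Omega> D"
  using assms by (auto simp: smooth_nets_def intro: smooth_fun_lincomb)

lemma eventually_abs_pderiv_on_lincomb_le:
  assumes "u \<in> smooth_nets \<Omega> D" "v \<in> smooth_nets \<Omega> D" "\<alpha> \<in> lists Basis" "K \<subseteq> D"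
    and "\<forall>\<^sub>F \<epsilon> in at_right 0. \<forall>x\<in>K. \<bar>pderiv_on \<Omega> \<alpha> (u \<epsilon>) x\<bar> \<le> B \<epsilon>"
    and "\<forall>\<^sub>F \<epsilon> in at_right 0. \<bar>r \<epsilon>\<bar> \<le> C \<epsilon>"
    and "\<forall>\<^sub>F \<epsilon> in at_right 0. \<forall>x\<in>K. \<bar>pderiv_on \<Omega> \<alpha> (v \<epsilon>) x\<bar> \<le> E \<epsilon>"
  shows "\<forall>\<^sub>F \<epsilon> in at_right 0. \<forall>x\<in>K. \<bar>pderiv_on \<Omega> \<alpha> (\<lambda>x. u \<epsilon> x + r \<epsilon> * v \<epsilon> x) x\<bar> \<le> B \<epsilon> + C \<epsilon> * E \<epsilon>"
  using assms(5-7) eventually_small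
proof eventually_elim
  case (elim \<epsilon>)
  show ?case
  proof
    fix x assume x: "x \<in> K"
    have "pderiv_on \<Omega> \<alpha> (\<lambda>x. u \<epsilon> x + r \<epsilon> * v \<epsilon> x) x = pderiv_on \<Omega> \<alpha> (u \<epsilon>) x + r \<epsilon> * pderiv_on \<Omega> \<alpha> (v \<epsilon>) x"
      using assms elim x by (intro pderiv_on_lincomb) (auto simp: smooth_nets_def)
    moreover have "\<bar>r \<epsilon> * pderiv_on \<Omega> \<alpha> (v \<epsilon>) x\<bar> \<le> C \<epsilon> * E \<epsilon>"
      unfolding abs_mult using elim x by (intro mult_mono) (auto intro: order_trans[OF abs_ge_zero])
    ultimately show "\<bar>pderiv_on \<Omega> \<alpha> (\<lambda>x. u \<epsilon> x + r \<epsilon> * v \<epsilon> x) x\<bar> \<le> B \<epsilon> + C \<epsilon> * E \<epsilon>"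
      using elim x abs_triangle_ineq[of "pderiv_on \<Omega> \<alpha> (u \<epsilon>) x" "r \<epsilon> * pderiv_on \<Omega> \<alpha> (v \<epsilon>) x"] by force
  qed
qed

lemma moderate_nets_lincomb:
  assumes "u \<in> moderate_nets \<Omega> D" "v \<in> moderate_nets \<Omega> D" "moderate r"
  shows "(\<lambda>\<epsilon> x. u \<epsilon> x + r \<epsilon> * v \<epsilon> x) \<in> moderate_nets \<Omega> D"
  unfolding moderate_nets_iff
proof (intro conjI allI impI)
  have sm: "u \<in> smooth_nets \<Omega> D" "v \<in> smooth_nets \<Omega> D" using assms by (auto simp: moderate_nets_iff)
  then show "(\<lambda>\<epsilon> x. u \<epsilon> x + r \<epsilon> * v \<epsilon> x) \<in> smooth_nets \<Omega> D" by (rule smooth_nets_lincomb)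
  fix K :: "'a set" and \<alpha> :: "'a list" assume *: "compact K" "K \<subseteq> D" "\<alpha> \<in> lists Basis"
  obtain N1 N2 N3 where N:
    "\<forall>\<^sub>F \<epsilon> in at_right 0. \<forall>x\<in>K. \<bar>pderiv_on \<Omega> \<alpha> (u \<epsilon>) x\<bar> \<le> inverse \<epsilon> ^ N1"
    "\<forall>\<^sub>F \<epsilon> in at_right 0. \<bar>r \<epsilon>\<bar> \<le> inverse \<epsilon> ^ N2"
    "\<forall>\<^sub>F \<epsilon> in at_right 0. \<forall>x\<in>K. \<bar>pderiv_on \<Omega> \<alpha> (v \<epsilon>) x\<bar> \<le> inverse \<epsilon> ^ N3"
    using assms * unfolding moderate_nets_iff moderate_iff by meson
  have pow: "moderate (\<lambda>\<epsilon>. inverse \<epsilon> ^ n)" for n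
    unfolding moderate_def by (rule exI[of _ n]) simp
  obtain N where "\<forall>\<^sub>F \<epsilon>::real in at_right 0. \<bar>inverse \<epsilon> ^ N1 + inverse \<epsilon> ^ N2 * inverse \<epsilon> ^ N3\<bar> \<le> inverse \<epsilon> ^ N"
    using moderate_add[OF pow[of N1] moderate_mult[OF pow[of N2] pow[of N3]]] unfolding moderate_iff ..
  with eventually_abs_pderiv_on_lincomb_le[OF sm *(3,2) N]
  have "\<forall>\<^sub>F \<epsilon> in at_right 0. \<forall>x\<in>K. \<bar>pderiv_on \<Omega> \<alpha> (\<lambda>x. u \<epsilon> x + r \<epsilon> * v \<epsilon> x) x\<bar> \<le> inverse \<epsilon> ^ N"
    by eventually_elim (meson abs_le_D1 order_trans)
  then show "\<exists>N. \<forall>\<^sub>F \<epsilon> in at_right 0. \<forall>x\<in>K. \<bar>pderiv_on \<Omega> \<alpha> (\<lambda>x. u \<epsilon> x + r \<epsilon> * v \<epsilon> x) x\<bar> \<le> inverse \<epsilon> ^ N" ..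
qed

lemma negligible_nets_lincomb:
  assumes "u \<in> negligible_nets \<Omega> D" "v \<in> negligible_nets \<Omega> D"
  shows "(\<lambda>\<epsilon> x. u \<epsilon> x + c * v \<epsilon> x) \<in> negligible_nets \<Omega> D"
  unfolding negligible_nets_iff
proof (intro conjI allI impI)
  have sm: "u \<in> smooth_nets \<Omega> D" "v \<in> smooth_nets \<Omega> D" using assms by (auto simp: negligible_nets_iff)
  then show "(\<lambda>\<epsilon> x. u \<epsilon> x + c * v \<epsilon> x) \<in> smooth_nets \<Omega> D" by (rule smooth_nets_lincomb)
  fix K :: "'a set" and \<alpha> :: "'a list" and m assume *: "compact K" "K \<subseteq> D" "\<alpha> \<in> lists Basis"
  have N: "\<forall>\<^sub>F \<epsilon> in at_right 0. \<forall>x\<in>K. \<bar>pderiv_on \<Omega> \<alpha> (u \<epsilon>) x\<bar> \<le> \<epsilon> ^ Suc m"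
    "\<forall>\<^sub>F \<epsilon>::real in at_right 0. \<bar>c\<bar> \<le> \<bar>c\<bar>"
    "\<forall>\<^sub>F \<epsilon> in at_right 0. \<forall>x\<in>K. \<bar>pderiv_on \<Omega> \<alpha> (v \<epsilon>) x\<bar> \<le> \<epsilon> ^ Suc m"
    using assms * unfolding negligible_nets_iff by (blast, simp, blast)
  have "(\<lambda>\<epsilon>. \<epsilon> ^ Suc m + \<bar>c\<bar> * \<epsilon> ^ Suc m) \<in> O[at_right 0](\<lambda>\<epsilon>::real. \<epsilon> ^ Suc m)"
    by (intro sum_in_bigo) simp_all
  from bigo_power_imp_le[OF this] eventually_abs_pderiv_on_lincomb_le[OF sm *(3,2) N]
  show "\<forall>\<^sub>F \<epsilon> in at_right 0. \<forall>x\<in>K. \<bar>pderiv_on \<Omega> \<alpha> (\<lambda>x. u \<epsilon> x + c * v \<epsilon> x) x\<bar> \<le> \<epsilon> ^ m"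
    by eventually_elim (meson abs_le_D1 order_trans)
qed

text \<open>
  The negligible coefficient beats the moderate growth of the derivatives of \<open>v\<close> on each compact set.
\<close>

lemma negligible_nets_scale:
  assumes "v \<in> moderate_nets \<Omega> D" "negligible_net r"
  shows "(\<lambda>\<epsilon> x. r \<epsilon> * v \<epsilon> x) \<in> negligible_nets \<Omega> D"
  unfolding negligible_nets_iff
proof (intro conjI allI impI)
  have sm: "v \<in> smooth_nets \<Omega> D" using assms by (auto simp: moderate_nets_iff)
  \<comment> \<open>Writing the multiple as a linear combination makes \<open>pderiv_on_lincomb\<close> applicable.\<close>
  have eq: "r \<epsilon> * v \<epsilon> x = v \<epsilon> x + (r \<epsilon> - 1) * v \<epsilon> x" for \<epsilon> x by (simp add: algebra_simps)
  show "(\<lambda>\<epsilon> x. r \<epsilon> * v \<epsilon> x) \<in> smooth_nets \<Omega> D"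
    unfolding eq by (rule smooth_nets_lincomb[OF sm sm])
  fix K :: "'a set" and \<alpha> :: "'a list" and m assume *: "compact K" "K \<subseteq> D" "\<alpha> \<in> lists Basis"
  obtain N where N: "\<forall>\<^sub>F \<epsilon> in at_right 0. \<forall>x\<in>K. \<bar>pderiv_on \<Omega> \<alpha> (v \<epsilon>) x\<bar> \<le> inverse \<epsilon> ^ N"
    using assms * unfolding moderate_nets_iff by meson
  from N negligible_netD[OF assms(2), of "m + N"] eventually_small
  show "\<forall>\<^sub>F \<epsilon> in at_right 0. \<forall>x\<in>K. \<bar>pderiv_on \<Omega> \<alpha> (\<lambda>x. r \<epsilon> * v \<epsilon> x) x\<bar> \<le> \<epsilon> ^ m"
  proof eventually_elim
    case (elim \<epsilon>)
    show ?case
    proof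
      fix x assume x: "x \<in> K"
      have v: "smooth_fun \<Omega> D (v \<epsilon>)" using sm elim by (auto simp: smooth_nets_def)
      have "pderiv_on \<Omega> \<alpha> (\<lambda>x. r \<epsilon> * v \<epsilon> x) x = r \<epsilon> * pderiv_on \<Omega> \<alpha> (v \<epsilon>) x"
        using pderiv_on_lincomb[OF v v *(3), of x "r \<epsilon> - 1"] x *(2) unfolding eq by (auto simp: algebra_simps)
      moreover have "\<bar>r \<epsilon>\<bar> * \<bar>pderiv_on \<Omega> \<alpha> (v \<epsilon>) x\<bar> \<le> \<epsilon> ^ (m + N) * inverse \<epsilon> ^ N"
        using elim x by (intro mult_mono) auto
      moreover have "\<epsilon> ^ (m + N) * inverse \<epsilon> ^ N = \<epsilon> ^ m"
        using elim by (simp add: power_add power_inverse)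
      ultimately show "\<bar>pderiv_on \<Omega> \<alpha> (\<lambda>x. r \<epsilon> * v \<epsilon> x) x\<bar> \<le> \<epsilon> ^ m"
        by (simp add: abs_mult)
    qed
  qed
qed

lemma colombeau_relI:
  "u \<in> moderate_nets \<Omega> D \<Longrightarrow> v \<in> moderate_nets \<Omega> D \<Longrightarrow> (\<lambda>\<epsilon> x. u \<epsilon> x - v \<epsilon> x) \<in> negligible_nets \<Omega> D
    \<Longrightarrow> (u, v) \<in> colombeau_rel \<Omega> D"
  by (simp add: colombeau_rel_def)

lemma negligible_nets_diff:
  "u \<in> negligible_nets \<Omega> D \<Longrightarrow> v \<in> negligible_nets \<Omega> D \<Longrightarrow> (\<lambda>\<epsilon> x. u \<epsilon> x - v \<epsilon> x) \<in> negligible_nets \<Omega> D"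
  using negligible_nets_lincomb[of u v "-1"] by simp

lemma negligible_nets_add:
  "u \<in> negligible_nets \<Omega> D \<Longrightarrow> v \<in> negligible_nets \<Omega> D \<Longrightarrow> (\<lambda>\<epsilon> x. u \<epsilon> x + v \<epsilon> x) \<in> negligible_nets \<Omega> D"
  using negligible_nets_lincomb[of u v 1] by simp

lemma zero_in_negligible_nets:
  "v \<in> moderate_nets \<Omega> D \<Longrightarrow> (\<lambda>\<epsilon> x. 0) \<in> negligible_nets \<Omega> D"
  using negligible_nets_scale[OF _ negligible_net_zero, of v] by simp

lemma equiv_colombeau_rel: "equiv (moderate_nets \<Omega> D) (colombeau_rel \<Omega> D)"
proof (rule equivI)
  show "colombeau_rel \<Omega> D \<subseteq> moderate_nets \<Omega> D \<times> moderate_nets \<Omega> D"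
    by (auto simp: colombeau_rel_def)
  show "refl_on (moderate_nets \<Omega> D) (colombeau_rel \<Omega> D)"
    by (auto simp: refl_on_def colombeau_rel_def zero_in_negligible_nets)
  show "sym (colombeau_rel \<Omega> D)"
  proof (rule symI)
    fix u v assume "(u, v) \<in> colombeau_rel \<Omega> D"
    then have *: "u \<in> moderate_nets \<Omega> D" "v \<in> moderate_nets \<Omega> D" "(\<lambda>\<epsilon> x. u \<epsilon> x - v \<epsilon> x) \<in> negligible_nets \<Omega> D"
      by (auto simp: colombeau_rel_def)
    from negligible_nets_diff[OF zero_in_negligible_nets[OF *(1)] *(3)]
    show "(v, u) \<in> colombeau_rel \<Omega> D" using * by (auto simp: colombeau_rel_def)
  qed
  show "trans (colombeau_rel \<Omega> D)"
  proof (rule transI)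
    fix u v w assume "(u, v) \<in> colombeau_rel \<Omega> D" "(v, w) \<in> colombeau_rel \<Omega> D"
    then show "(u, w) \<in> colombeau_rel \<Omega> D"
      using negligible_nets_add[of "\<lambda>\<epsilon> x. u \<epsilon> x - v \<epsilon> x" "\<lambda>\<epsilon> x. v \<epsilon> x - w \<epsilon> x"]
      by (auto simp: colombeau_rel_def)
  qed
qed

lemma colombeau_class:
  assumes "U \<in> colombeau \<Omega> D" "u \<in> U"
  shows "u \<in> moderate_nets \<Omega> D" "U = colombeau_rel \<Omega> D `` {u}"
proof -
  from assms(1) obtain w where w: "w \<in> moderate_nets \<Omega> D" "U = colombeau_rel \<Omega> D `` {w}"
    unfolding colombeau_def by (rule quotientE)
  then have wu: "(w, u) \<in> colombeau_rel \<Omega> D" using assms(2) by simp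
  then show "u \<in> moderate_nets \<Omega> D" by (simp add: colombeau_rel_def)
  show "U = colombeau_rel \<Omega> D `` {u}"
    using equiv_class_eq[OF equiv_colombeau_rel wu] w(2) by simp
qed

lemma colombeau_nonempty: "U \<in> colombeau \<Omega> D \<Longrightarrow> \<exists>u. u \<in> U"
  unfolding colombeau_def using in_quotient_imp_non_empty[OF equiv_colombeau_rel] by blast

text \<open>
  Representatives of the scalar \<open>0\<close> are arbitrary negligible nets, so the left-hand side consists of
  perturbations of representatives of \<open>U\<close> by negligible multiples of moderate nets.
\<close>

lemma gf_add_scale_0:
  assumes U: "U \<in> colombeau \<Omega> D" and V: "V \<in> colombeau \<Omega> D"
  shows "gf_add \<Omega> D U (gf_scale \<Omega> D 0 V) = U"
proof
  show "gf_add \<Omega> D U (gf_scale \<Omega> D 0 V) \<subseteq> U"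
  proof
    fix y assume "y \<in> gf_add \<Omega> D U (gf_scale \<Omega> D 0 V)"
    then obtain u w r v where *: "u \<in> U" "r \<in> gen_real_reps 0" "v \<in> V"
      "((\<lambda>\<epsilon> x. r \<epsilon> * v \<epsilon> x), w) \<in> colombeau_rel \<Omega> D" "((\<lambda>\<epsilon> x. u \<epsilon> x + w \<epsilon> x), y) \<in> colombeau_rel \<Omega> D"
      unfolding gf_add_def gf_scale_def by auto
    have u: "u \<in> moderate_nets \<Omega> D" and v: "v \<in> moderate_nets \<Omega> D"
      using colombeau_class *(1,3) U V by blast+
    have "negligible_net r" using *(2) by (auto simp: gen_real_reps_def abs_gen_real_eq_0_iff)
    then have rv: "(\<lambda>\<epsilon> x. r \<epsilon> * v \<epsilon> x) \<in> negligible_nets \<Omega> D" using v by (intro negligible_nets_scale)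
    have "(\<lambda>\<epsilon> x. r \<epsilon> * v \<epsilon> x - w \<epsilon> x) \<in> negligible_nets \<Omega> D"
      using *(4) by (simp add: colombeau_rel_def)
    from negligible_nets_diff[OF this rv]
    have "(\<lambda>\<epsilon> x. u \<epsilon> x - (u \<epsilon> x + w \<epsilon> x)) \<in> negligible_nets \<Omega> D" by simp
    then have "(u, (\<lambda>\<epsilon> x. u \<epsilon> x + w \<epsilon> x)) \<in> colombeau_rel \<Omega> D"
      using u *(5) by (simp add: colombeau_rel_def)
    with *(5) have "(u, y) \<in> colombeau_rel \<Omega> D" using equiv_colombeau_rel by (meson equiv_def transD)
    then show "y \<in> U" using colombeau_class(2)[OF U *(1)] by simp
  qed
  show "U \<subseteq> gf_add \<Omega> D U (gf_scale \<Omega> D 0 V)"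
  proof
    fix u assume u: "u \<in> U"
    obtain v where v: "v \<in> V" using colombeau_nonempty[OF V] ..
    have um: "(u, u) \<in> colombeau_rel \<Omega> D"
      using colombeau_class[OF U u] u by blast
    have zero: "(\<lambda>\<epsilon>. 0) \<in> gen_real_reps 0"
      by (simp add: gen_real_reps_def moderate_const zero_gen_real.abs_eq)
    have vm: "v \<in> moderate_nets \<Omega> D" using colombeau_class(1)[OF V v] .
    have "(\<lambda>\<epsilon> x. 0) \<in> moderate_nets \<Omega> D"
      using moderate_nets_lincomb[OF vm vm moderate_const[of "-1"]] by simp
    then have "((\<lambda>\<epsilon> x. 0 * v \<epsilon> x), \<lambda>\<epsilon> x. 0) \<in> colombeau_rel \<Omega> D"
      using zero_in_negligible_nets[OF vm] by (simp add: colombeau_rel_def)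
    then have "(\<lambda>\<epsilon> x. 0) \<in> gf_scale \<Omega> D 0 V"
      unfolding gf_scale_def using v zero by (intro ImageI[where a = "\<lambda>\<epsilon> x. 0 * v \<epsilon> x"]) force+
    then have "(\<lambda>\<epsilon> x. u \<epsilon> x + 0) \<in> {\<lambda>\<epsilon> x. u \<epsilon> x + v \<epsilon> x | u v. u \<in> U \<and> v \<in> gf_scale \<Omega> D 0 V}"
      using u by (intro CollectI exI[of _ u] exI[of _ "\<lambda>\<epsilon> x. 0"]) simp
    then show "u \<in> gf_add \<Omega> D U (gf_scale \<Omega> D 0 V)"
      unfolding gf_add_def using um by auto
  qed
qed

lemma moderate_nets_pderiv_on:
  assumes "u \<in> moderate_nets \<Omega> D" "\<alpha> \<in> lists Basis"
  shows "(\<lambda>\<epsilon>. pderiv_on \<Omega> \<alpha> (u \<epsilon>)) \<in> moderate_nets \<Omega> D"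
  unfolding moderate_nets_iff
proof (intro conjI allI impI)
  have sm: "smooth_fun \<Omega> D (u \<epsilon>)" if "0 < \<epsilon> \<and> \<epsilon> \<le> 1" for \<epsilon>
    using assms that by (simp add: moderate_nets_iff smooth_nets_def)
  show "(\<lambda>\<epsilon>. pderiv_on \<Omega> \<alpha> (u \<epsilon>)) \<in> smooth_nets \<Omega> D"
    using sm assms(2) by (simp add: smooth_nets_def smooth_fun_pderiv_on)
  fix K :: "'a set" and \<beta> :: "'a list" assume *: "compact K" "K \<subseteq> D" "\<beta> \<in> lists Basis"
  then have "\<beta> @ \<alpha> \<in> lists Basis" using assms(2) by simp
  then obtain N where "\<forall>\<^sub>F \<epsilon> in at_right 0. \<forall>x\<in>K. \<bar>pderiv_on \<Omega> (\<beta> @ \<alpha>) (u \<epsilon>) x\<bar> \<le> inverse \<epsilon> ^ N"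
    using assms(1) * unfolding moderate_nets_iff by meson
  with eventually_small
  have "\<forall>\<^sub>F \<epsilon> in at_right 0. \<forall>x\<in>K. \<bar>pderiv_on \<Omega> \<beta> (pderiv_on \<Omega> \<alpha> (u \<epsilon>)) x\<bar> \<le> inverse \<epsilon> ^ N"
    by eventually_elim (use sm assms(2) * in \<open>auto simp: pderiv_on_pderiv_on subset_iff\<close>)
  then show "\<exists>N. \<forall>\<^sub>F \<epsilon> in at_right 0. \<forall>x\<in>K. \<bar>pderiv_on \<Omega> \<beta> (pderiv_on \<Omega> \<alpha> (u \<epsilon>)) x\<bar> \<le> inverse \<epsilon> ^ N" ..
qed

lemma negligible_nets_pderiv_on_diff:
  assumes "(u, v) \<in> colombeau_rel \<Omega> D" "\<alpha> \<in> lists Basis"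
  shows "(\<lambda>\<epsilon> x. pderiv_on \<Omega> \<alpha> (u \<epsilon>) x - pderiv_on \<Omega> \<alpha> (v \<epsilon>) x) \<in> negligible_nets \<Omega> D"
  unfolding negligible_nets_iff
proof (intro conjI allI impI)
  let ?d = "\<lambda>\<epsilon> x. u \<epsilon> x - v \<epsilon> x"
  have d: "?d \<in> negligible_nets \<Omega> D" using assms(1) by (simp add: colombeau_rel_def)
  have sm: "smooth_fun \<Omega> D (u \<epsilon>)" "smooth_fun \<Omega> D (v \<epsilon>)" "smooth_fun \<Omega> D (?d \<epsilon>)" if "0 < \<epsilon> \<and> \<epsilon> \<le> 1" for \<epsilon>
    using assms d that by (simp_all add: colombeau_rel_def negligible_nets_iff moderate_nets_iff smooth_nets_def)
  have smd: "smooth_fun \<Omega> D (pderiv_on \<Omega> \<alpha> (u \<epsilon>))" "smooth_fun \<Omega> D (pderiv_on \<Omega> \<alpha> (v \<epsilon>))"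
    if "0 < \<epsilon> \<and> \<epsilon> \<le> 1" for \<epsilon>
    using sm[OF that] assms(2) by (simp_all add: smooth_fun_pderiv_on)
  show "(\<lambda>\<epsilon> x. pderiv_on \<Omega> \<alpha> (u \<epsilon>) x - pderiv_on \<Omega> \<alpha> (v \<epsilon>) x) \<in> smooth_nets \<Omega> D"
    using smooth_fun_lincomb[OF smd, where c = "-1"] by (simp add: smooth_nets_def)
  fix K :: "'a set" and \<beta> :: "'a list" and m assume *: "compact K" "K \<subseteq> D" "\<beta> \<in> lists Basis"
  have ba: "\<beta> @ \<alpha> \<in> lists Basis" using assms(2) * by simp
  then have "\<forall>\<^sub>F \<epsilon> in at_right 0. \<forall>x\<in>K. \<bar>pderiv_on \<Omega> (\<beta> @ \<alpha>) (?d \<epsilon>) x\<bar> \<le> \<epsilon> ^ m"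
    using d * unfolding negligible_nets_iff by meson
  with eventually_small
  show "\<forall>\<^sub>F \<epsilon> in at_right 0. \<forall>x\<in>K.
      \<bar>pderiv_on \<Omega> \<beta> (\<lambda>x. pderiv_on \<Omega> \<alpha> (u \<epsilon>) x - pderiv_on \<Omega> \<alpha> (v \<epsilon>) x) x\<bar> \<le> \<epsilon> ^ m"
  proof eventually_elim
    case (elim \<epsilon>)
    then have e: "0 < \<epsilon> \<and> \<epsilon> \<le> 1" by simp
    have "pderiv_on \<Omega> \<beta> (\<lambda>x. pderiv_on \<Omega> \<alpha> (u \<epsilon>) x - pderiv_on \<Omega> \<alpha> (v \<epsilon>) x) x
        = pderiv_on \<Omega> (\<beta> @ \<alpha>) (?d \<epsilon>) x" if "x \<in> K" for x
    proof -
      have x: "x \<in> D" using that * by blast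
      show ?thesis
        using pderiv_on_lincomb[OF smd[OF e] *(3) x, of "-1"] pderiv_on_lincomb[OF sm(1,2)[OF e] ba x, of "-1"]
          pderiv_on_pderiv_on[OF sm(1)[OF e] assms(2) *(3) x] pderiv_on_pderiv_on[OF sm(2)[OF e] assms(2) *(3) x]
        by simp
    qed
    then show ?case using elim by simp
  qed
qed

text \<open>
  Derivatives of equivalent nets are equivalent, because a derivative of the difference of order \<open>\<beta>\<close> is a
  derivative of order \<open>\<beta> @ \<alpha>\<close> of a negligible net. Any one representative therefore suffices.
\<close>

lemma gf_pderiv_class:
  assumes U: "U \<in> colombeau \<Omega> D" and u: "u \<in> U" and \<alpha>: "\<alpha> \<in> lists Basis"
  shows "gf_pderiv \<Omega> D \<alpha> U = colombeau_rel \<Omega> D `` {\<lambda>\<epsilon>. pderiv_on \<Omega> \<alpha> (u \<epsilon>)}"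
proof -
  have "colombeau_rel \<Omega> D `` {\<lambda>\<epsilon>. pderiv_on \<Omega> \<alpha> (w \<epsilon>)} = colombeau_rel \<Omega> D `` {\<lambda>\<epsilon>. pderiv_on \<Omega> \<alpha> (u \<epsilon>)}"
    if "w \<in> U" for w
  proof (rule equiv_class_eq[OF equiv_colombeau_rel])
    have "(w, u) \<in> colombeau_rel \<Omega> D" using colombeau_class(2)[OF U that] u by blast
    then show "((\<lambda>\<epsilon>. pderiv_on \<Omega> \<alpha> (w \<epsilon>)), (\<lambda>\<epsilon>. pderiv_on \<Omega> \<alpha> (u \<epsilon>))) \<in> colombeau_rel \<Omega> D"
      using colombeau_class(1)[OF U] u that \<alpha> negligible_nets_pderiv_on_diff
      by (intro colombeau_relI moderate_nets_pderiv_on) auto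
  qed
  then show ?thesis unfolding gf_pderiv_def using u by blast
qed

end

section \<open>Generalized functions on an interval\<close>

locale interval_around_zero =
  fixes J :: "real set"
  assumes open_J: "open J" and interval_J: "is_interval J" and zero_in_J: "0 \<in> J"
begin

sublocale smooth_domain J J
  by unfold_locales (use open_J closure_subset in auto)

lemma DERIV_iter_pderiv:
  assumes "smooth_fun J J f" "x \<in> J"
  shows "(iter_pderiv (replicate k 1) f has_field_derivative iter_pderiv (replicate (Suc k) 1) f x) (at x)"
proof -
  have "((\<lambda>t. iter_pderiv (replicate k 1) f (t + x)) has_field_derivative
      iter_pderiv (replicate (Suc k) 1) f x) (at 0)"
    using smooth_fun_has_derivative[OF assms(1) _ _ assms(2), of "replicate k 1" 1]
    by (simp add: add.commute in_lists_conv_set)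
  then show ?thesis using DERIV_shift[of _ _ 0 x] by simp
qed

lemma moderate_nets_bound:
  assumes "f \<in> moderate_nets J J" "compact K" "K \<subseteq> J"
  shows "\<exists>N. \<forall>\<^sub>F \<epsilon> in at_right 0. \<forall>x\<in>K. \<bar>iter_pderiv (replicate k 1) (f \<epsilon>) x\<bar> \<le> inverse \<epsilon> ^ N"
proof -
  have "replicate k (1::real) \<in> lists Basis" by (simp add: in_lists_conv_set)
  then obtain N where "\<forall>\<^sub>F \<epsilon> in at_right 0. \<forall>x\<in>K. \<bar>pderiv_on J (replicate k 1) (f \<epsilon>) x\<bar> \<le> inverse \<epsilon> ^ N"
    using assms unfolding moderate_nets_iff by meson
  moreover have "\<forall>x\<in>K. pderiv_on J (replicate k 1) (f \<epsilon>) x = iter_pderiv (replicate k 1) (f \<epsilon>) x" for \<epsilon>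
    using assms(3) by (auto simp: pderiv_on_def)
  ultimately show ?thesis by auto
qed

lemma moderate_compact_net:
  assumes "r \<in> compact_nets J" shows "moderate r"
proof -
  obtain K where K: "compact K" "\<forall>\<^sub>F \<epsilon> in at_right 0. r \<epsilon> \<in> K"
    using assms by (auto simp: compact_nets_def)
  obtain B where B: "\<And>x. x \<in> K \<Longrightarrow> norm x \<le> B"
    using compact_imp_bounded[OF K(1)] unfolding bounded_iff by blast
  have "r \<in> O[at_right 0](\<lambda>\<epsilon>. inverse \<epsilon> ^ 0)"
    by (rule bigoI[where c = B], rule eventually_mono[OF K(2)]) (use B in simp)
  then show ?thesis unfolding moderate_def by blast
qed

lemma moderate_value:
  assumes "f \<in> moderate_nets J J" "r \<in> compact_nets J"
  shows "moderate (\<lambda>\<epsilon>. f \<epsilon> (r \<epsilon>))"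
proof -
  obtain K where K: "compact K" "K \<subseteq> J" "\<forall>\<^sub>F \<epsilon> in at_right 0. r \<epsilon> \<in> K"
    using assms by (auto simp: compact_nets_def)
  obtain N where "\<forall>\<^sub>F \<epsilon> in at_right 0. \<forall>x\<in>K. \<bar>iter_pderiv (replicate 0 1) (f \<epsilon>) x\<bar> \<le> inverse \<epsilon> ^ N"
    using moderate_nets_bound[OF assms(1) K(1,2)] by blast
  with K(3) have "\<forall>\<^sub>F \<epsilon> in at_right 0. \<bar>f \<epsilon> (r \<epsilon>)\<bar> \<le> inverse \<epsilon> ^ N"
    by eventually_elim simp
  then show ?thesis unfolding moderate_iff by blast
qed

lemma negligible_value_diff:
  assumes "(f, g) \<in> colombeau_rel J J" "r \<in> compact_nets J"
  shows "negligible_net (\<lambda>\<epsilon>. f \<epsilon> (r \<epsilon>) - g \<epsilon> (r \<epsilon>))"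
  unfolding negligible_net_iff
proof
  fix m
  obtain K where K: "compact K" "K \<subseteq> J" "\<forall>\<^sub>F \<epsilon> in at_right 0. r \<epsilon> \<in> K"
    using assms by (auto simp: compact_nets_def)
  have "\<forall>\<^sub>F \<epsilon> in at_right 0. \<forall>x\<in>K. \<bar>pderiv_on J [] (\<lambda>x. f \<epsilon> x - g \<epsilon> x) x\<bar> \<le> \<epsilon> ^ m"
    using assms(1) K(1,2) by (simp add: colombeau_rel_def negligible_nets_iff)
  with K(3) show "\<forall>\<^sub>F \<epsilon> in at_right 0. \<bar>f \<epsilon> (r \<epsilon>) - g \<epsilon> (r \<epsilon>)\<bar> \<le> \<epsilon> ^ m"
    by eventually_elim (use K(2) in \<open>auto simp: pderiv_on_def subset_iff\<close>)
qed

text \<open>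
  By the mean value inequality the difference is at most the moderate bound on the derivative times
  \<open>\<bar>r - s\<bar>\<close>. The inequality needs a convex set on which the derivative is controlled: the convex
  hull of the two compact sets, which stays inside the interval.
\<close>

lemma negligible_argument_diff:
  assumes f: "f \<in> moderate_nets J J" and r: "r \<in> compact_nets J" and s: "s \<in> compact_nets J"
    and rs: "negligible_net (\<lambda>\<epsilon>. r \<epsilon> - s \<epsilon>)"
  shows "negligible_net (\<lambda>\<epsilon>. f \<epsilon> (r \<epsilon>) - f \<epsilon> (s \<epsilon>))"
  unfolding negligible_net_iff
proof
  fix m
  obtain K where K: "compact K" "K \<subseteq> J" "\<forall>\<^sub>F \<epsilon> in at_right 0. r \<epsilon> \<in> K"
    using r by (auto simp: compact_nets_def)
  obtain K' where K': "compact K'" "K' \<subseteq> J" "\<forall>\<^sub>F \<epsilon> in at_right 0. s \<epsilon> \<in> K'"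
    using s by (auto simp: compact_nets_def)
  define H where "H = convex hull (K \<union> K')"
  have H: "compact H" "H \<subseteq> J" "K \<subseteq> H" "K' \<subseteq> H" "convex H"
    using K K' interval_J hull_subset[of "K \<union> K'" convex] hull_minimal[of "K \<union> K'" J convex] unfolding H_def
    by (auto intro!: compact_convex_hull compact_Un simp: is_interval_convex_1)
  obtain N where N: "\<forall>\<^sub>F \<epsilon> in at_right 0. \<forall>x\<in>H. \<bar>iter_pderiv (replicate 1 1) (f \<epsilon>) x\<bar> \<le> inverse \<epsilon> ^ N"
    using moderate_nets_bound[OF f H(1,2)] by blast
  show "\<forall>\<^sub>F \<epsilon> in at_right 0. \<bar>f \<epsilon> (r \<epsilon>) - f \<epsilon> (s \<epsilon>)\<bar> \<le> \<epsilon> ^ m"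
    using K(3) K'(3) N negligible_netD[OF rs, of "m + N"] eventually_small
  proof eventually_elim
    case (elim \<epsilon>)
    have sm: "smooth_fun J J (f \<epsilon>)" using f elim by (simp add: moderate_nets_iff smooth_nets_def)
    have "norm (f \<epsilon> (r \<epsilon>) - f \<epsilon> (s \<epsilon>)) \<le> inverse \<epsilon> ^ N * norm (r \<epsilon> - s \<epsilon>)"
    proof (rule field_differentiable_bound[OF H(5)])
      show "(f \<epsilon> has_field_derivative iter_pderiv (replicate 1 1) (f \<epsilon>) z) (at z within H)" if "z \<in> H" for z
        using DERIV_iter_pderiv[OF sm, of z 0] H(2) that by (auto intro: has_field_derivative_at_within)
    qed (use elim H in auto)
    also have "\<dots> \<le> inverse \<epsilon> ^ N * \<epsilon> ^ (m + N)"
      using elim by (intro mult_left_mono) auto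
    also have "\<dots> = \<epsilon> ^ m" using elim by (simp add: power_add power_inverse)
    finally show ?case by simp
  qed
qed

lemma point_value_eq:
  assumes f: "f \<in> moderate_nets J J" and r: "r \<in> compact_nets J"
  shows "point_value J (colombeau_rel J J `` {f}) (abs_gen_real r) = abs_gen_real (\<lambda>\<epsilon>. f \<epsilon> (r \<epsilon>))"
  unfolding point_value_def
proof (rule the_equality)
  have "(f, f) \<in> colombeau_rel J J" using equiv_class_self[OF equiv_colombeau_rel f] by simp
  then show "\<exists>h\<in>colombeau_rel J J `` {f}. \<exists>s\<in>compact_nets J \<inter> gen_real_reps (abs_gen_real r).
      abs_gen_real (\<lambda>\<epsilon>. f \<epsilon> (r \<epsilon>)) = abs_gen_real (\<lambda>\<epsilon>. h \<epsilon> (s \<epsilon>))"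
    using r moderate_compact_net[OF r] by (intro bexI[of _ f] bexI[of _ r]) (auto simp: gen_real_reps_def)
next
  fix y assume "\<exists>h\<in>colombeau_rel J J `` {f}. \<exists>s\<in>compact_nets J \<inter> gen_real_reps (abs_gen_real r).
      y = abs_gen_real (\<lambda>\<epsilon>. h \<epsilon> (s \<epsilon>))"
  then obtain h s where hs: "(f, h) \<in> colombeau_rel J J" "s \<in> compact_nets J"
    "s \<in> gen_real_reps (abs_gen_real r)" "y = abs_gen_real (\<lambda>\<epsilon>. h \<epsilon> (s \<epsilon>))" by auto
  have h: "h \<in> moderate_nets J J" using hs(1) by (simp add: colombeau_rel_def)
  have "negligible_net (\<lambda>\<epsilon>. r \<epsilon> - s \<epsilon>)"
    using hs(3) moderate_compact_net[OF r]
      abs_gen_real_eq_iff[of r s] by (auto simp: gen_real_reps_def gen_real_rel_def)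
  from negligible_net_add[OF negligible_argument_diff[OF f r hs(2) this] negligible_value_diff[OF hs(1,2)]]
  have "gen_real_rel (\<lambda>\<epsilon>. f \<epsilon> (r \<epsilon>)) (\<lambda>\<epsilon>. h \<epsilon> (s \<epsilon>))"
    using moderate_value[OF f r] moderate_value[OF h hs(2)] by (simp add: gen_real_rel_def)
  then show "y = abs_gen_real (\<lambda>\<epsilon>. f \<epsilon> (r \<epsilon>))"
    using hs(4) abs_gen_real_eq_iff[OF moderate_value[OF f r] moderate_value[OF h hs(2)]] by simp
qed

lemma zero_compact_net: "(\<lambda>\<epsilon>. 0) \<in> compact_nets J"
  using zero_in_J by (auto simp: compact_nets_def intro!: exI[of _ "{0}"])

lemma gf_pderiv_value_at_zero:
  assumes "g \<in> colombeau J J" "f \<in> g"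
  shows "point_value J (gf_pderiv J J (replicate k 1) g) 0
    = abs_gen_real (\<lambda>\<epsilon>. iter_pderiv (replicate k 1) (f \<epsilon>) 0)"
proof -
  have k: "replicate k (1::real) \<in> lists Basis" by (simp add: in_lists_conv_set)
  have f: "f \<in> moderate_nets J J" using colombeau_class(1)[OF assms] .
  show ?thesis
    using point_value_eq[OF moderate_nets_pderiv_on[OF f k] zero_compact_net] zero_in_J
    by (simp add: gf_pderiv_class[OF assms k] zero_gen_real.abs_eq pderiv_on_def)
qed

section \<open>Necessary conditions for a minimum at zero\<close>

text \<open>
  The exponent \<open>N\<close> does not depend on \<open>x\<close>, so the step may afterwards be chosen as a power of \<open>\<epsilon>\<close>
  depending on \<open>N\<close>.
\<close>

lemma taylor_estimate:
  assumes f: "f \<in> moderate_nets J J" and d: "0 \<le> d" "{-d..d} \<subseteq> J"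
  shows "\<exists>N. \<forall>\<^sub>F \<epsilon> in at_right 0. \<forall>x\<in>{-d..d}.
    \<bar>f \<epsilon> x - (\<Sum>m<n. iter_pderiv (replicate m 1) (f \<epsilon>) 0 / fact m * x ^ m)\<bar> \<le> inverse \<epsilon> ^ N * \<bar>x\<bar> ^ n"
proof -
  obtain N where "\<forall>\<^sub>F \<epsilon> in at_right 0. \<forall>x\<in>{-d..d}. \<bar>iter_pderiv (replicate n 1) (f \<epsilon>) x\<bar> \<le> inverse \<epsilon> ^ N"
    using moderate_nets_bound[OF f compact_Icc d(2)] by blast
  then have "\<forall>\<^sub>F \<epsilon> in at_right 0. \<forall>x\<in>{-d..d}.
    \<bar>f \<epsilon> x - (\<Sum>m<n. iter_pderiv (replicate m 1) (f \<epsilon>) 0 / fact m * x ^ m)\<bar> \<le> inverse \<epsilon> ^ N * \<bar>x\<bar> ^ n"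
    using eventually_small
  proof eventually_elim
    case (elim \<epsilon>)
    have sm: "smooth_fun J J (f \<epsilon>)" using f elim by (simp add: moderate_nets_iff smooth_nets_def)
    show ?case
    proof
      fix x assume x: "x \<in> {-d..d}"
      have "\<exists>t. \<bar>t\<bar> \<le> \<bar>x\<bar> \<and> f \<epsilon> x = (\<Sum>m<n. iter_pderiv (replicate m 1) (f \<epsilon>) 0 / fact m * x ^ m)
          + iter_pderiv (replicate n 1) (f \<epsilon>) t / fact n * x ^ n"
      proof (rule Maclaurin_bi_le)
        show "\<forall>m t. m < n \<and> \<bar>t\<bar> \<le> \<bar>x\<bar> \<longrightarrow>
            (iter_pderiv (replicate m 1) (f \<epsilon>) has_field_derivative iter_pderiv (replicate (Suc m) 1) (f \<epsilon>) t) (at t)"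
        proof (intro allI impI DERIV_iter_pderiv sm)
          fix m t assume "m < n \<and> \<bar>t\<bar> \<le> \<bar>x\<bar>"
          then have "t \<in> {-d..d}" using x by auto
          then show "t \<in> J" using d(2) by blast
        qed
      qed simp
      then obtain t where t: "\<bar>t\<bar> \<le> \<bar>x\<bar>" "f \<epsilon> x = (\<Sum>m<n. iter_pderiv (replicate m 1) (f \<epsilon>) 0 / fact m * x ^ m)
          + iter_pderiv (replicate n 1) (f \<epsilon>) t / fact n * x ^ n" by blast
      have "t \<in> {-d..d}" using t(1) x by auto
      then have "\<bar>iter_pderiv (replicate n 1) (f \<epsilon>) t\<bar> \<le> inverse \<epsilon> ^ N" using elim by blast
      moreover have "\<bar>iter_pderiv (replicate n 1) (f \<epsilon>) t\<bar> / fact n \<le> \<bar>iter_pderiv (replicate n 1) (f \<epsilon>) t\<bar>"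
        by (simp add: divide_le_eq mult_ge1_I[OF _] mult_le_cancel_left1 fact_ge_1)
      ultimately have "\<bar>iter_pderiv (replicate n 1) (f \<epsilon>) t\<bar> / fact n * \<bar>x\<bar> ^ n \<le> inverse \<epsilon> ^ N * \<bar>x\<bar> ^ n"
        by (intro mult_right_mono) auto
      then show "\<bar>f \<epsilon> x - (\<Sum>m<n. iter_pderiv (replicate m 1) (f \<epsilon>) 0 / fact m * x ^ m)\<bar> \<le> inverse \<epsilon> ^ N * \<bar>x\<bar> ^ n"
        using t(2) by (simp add: abs_mult power_abs)
    qed
  qed
  then show ?thesis ..
qed

lemma exists_symmetric_interval: "\<exists>d>0. {-d..d} \<subseteq> J"
proof -
  obtain d where "d > 0" "cball 0 d \<subseteq> J" using open_J zero_in_J open_contains_cball by blast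
  then show ?thesis by (auto simp: cball_eq_atLeastAtMost)
qed

text \<open>
  A representative has to lie in the interval for every \<open>\<epsilon>\<close> in \<open>(0,1]\<close>, also for those where \<open>\<epsilon>\<^sup>k\<close>
  is still too large; truncation at \<open>d\<close> achieves this without changing the net near \<open>0\<close>.
\<close>

lemma test_net:
  assumes "0 < d" "{-d..d} \<subseteq> J" "\<And>\<epsilon>. \<bar>\<sigma> \<epsilon>\<bar> \<le> 1"
  shows "(\<lambda>\<epsilon>. \<sigma> \<epsilon> * min d (\<epsilon> ^ k)) \<in> compact_nets J"
proof -
  have "\<sigma> \<epsilon> * min d (\<epsilon> ^ k) \<in> {-d..d}" if "0 < \<epsilon>" for \<epsilon>
  proof -
    have "\<bar>\<sigma> \<epsilon>\<bar> * \<bar>min d (\<epsilon> ^ k)\<bar> \<le> 1 * d"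
      using assms that by (intro mult_mono) auto
    then show ?thesis by (auto simp: abs_mult[symmetric] abs_le_iff)
  qed
  then show ?thesis
    unfolding compact_nets_def using assms(2) eventually_small
    by (auto intro!: exI[of _ "{-d..d}"] elim!: eventually_mono)
qed

lemma eventually_power_le:
  assumes "0 < (d::real)" shows "\<forall>\<^sub>F \<epsilon> in at_right 0. \<epsilon> ^ Suc k \<le> d"
proof -
  have "\<forall>\<^sub>F \<epsilon> in at_right 0. \<epsilon> \<in> {0<..<d}" using assms by (rule eventually_at_right_real)
  with eventually_small show ?thesis
  proof eventually_elim
    case (elim \<epsilon>)
    then have "\<epsilon> ^ Suc k \<le> \<epsilon>" using power_decreasing[of 1 "Suc k" \<epsilon>] by simp
    then show ?case using elim by (simp del: power_Suc)
  qed
qed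

context
  fixes f :: "real \<Rightarrow> real \<Rightarrow> real"
  assumes f: "f \<in> moderate_nets J J"
    and minimum: "\<And>r. r \<in> compact_nets J \<Longrightarrow> abs_gen_real (\<lambda>\<epsilon>. f \<epsilon> 0) \<le> abs_gen_real (\<lambda>\<epsilon>. f \<epsilon> (r \<epsilon>))"
begin

lemma eventually_increment_ge:
  assumes "r \<in> compact_nets J"
  shows "\<forall>\<^sub>F \<epsilon> in at_right 0. - (\<epsilon> ^ p) \<le> f \<epsilon> (r \<epsilon>) - f \<epsilon> 0"
proof (rule abs_gen_real_nonnegD)
  have m: "moderate (\<lambda>\<epsilon>. f \<epsilon> (r \<epsilon>))" "moderate (\<lambda>\<epsilon>. f \<epsilon> 0)"
    using moderate_value[OF f assms] moderate_value[OF f zero_compact_net] by auto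
  then show "moderate (\<lambda>\<epsilon>. f \<epsilon> (r \<epsilon>) - f \<epsilon> 0)" by (rule moderate_diff)
  show "0 \<le> abs_gen_real (\<lambda>\<epsilon>. f \<epsilon> (r \<epsilon>) - f \<epsilon> 0)"
    using minimum[OF assms] by (simp add: less_eq_gen_real_def abs_gen_real_diff[OF m, symmetric])
qed

text \<open>
  Moving against the sign of the derivative \<open>b\<close> by \<open>h = \<epsilon>\<^sup>k\<close> changes the value by \<open>-\<bar>b\<bar> h\<close> up to a
  quadratic remainder, and minimality bounds this from below by \<open>-h \<epsilon>\<^sup>m\<close>. Dividing by \<open>h\<close> bounds \<open>\<bar>b\<bar>\<close>.
\<close>

lemma negligible_first_derivative: "negligible_net (\<lambda>\<epsilon>. iter_pderiv [1] (f \<epsilon>) 0)"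
proof (rule negligible_netI[where C = 2])
  fix m
  define b where "b \<epsilon> = iter_pderiv [1] (f \<epsilon>) 0" for \<epsilon>
  obtain d where d: "d > 0" "{-d..d} \<subseteq> J" using exists_symmetric_interval by blast
  obtain N where N: "\<forall>\<^sub>F \<epsilon> in at_right 0. \<forall>x\<in>{-d..d}.
    \<bar>f \<epsilon> x - (\<Sum>m<2. iter_pderiv (replicate m 1) (f \<epsilon>) 0 / fact m * x ^ m)\<bar> \<le> inverse \<epsilon> ^ N * \<bar>x\<bar> ^ 2"
    using taylor_estimate[OF f _ d(2), of 2] d(1) by auto
  \<comment> \<open>One power of the step pays for the moderate bound and leaves a factor \<open>\<epsilon>\<^sup>m\<close>; the successor makes
    the exponent positive, so that the step tends to \<open>0\<close> and the truncation is eventually inactive.\<close>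
  define k where "k = Suc (N + m)"
  define r where "r \<epsilon> = - sgn (b \<epsilon>) * min d (\<epsilon> ^ k)" for \<epsilon>
  have r: "r \<in> compact_nets J" unfolding r_def using d by (intro test_net) (auto simp: sgn_if)
  show "\<forall>\<^sub>F \<epsilon> in at_right 0. \<bar>iter_pderiv [1] (f \<epsilon>) 0\<bar> \<le> 2 * \<epsilon> ^ m"
    using N eventually_increment_ge[OF r, of "k + m"] eventually_power_le[OF d(1), of "N + m"] eventually_small
  proof eventually_elim
    case (elim \<epsilon>)
    have reps: "r \<epsilon> = - sgn (b \<epsilon>) * \<epsilon> ^ k" using elim by (simp add: r_def k_def)
    have rabs: "\<bar>r \<epsilon>\<bar> \<le> \<epsilon> ^ k" using elim by (auto simp: reps abs_mult abs_sgn_eq)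
    have "r \<epsilon> \<in> {-d..d}" using rabs elim by (simp add: k_def abs_le_iff)
    then have T: "\<bar>f \<epsilon> (r \<epsilon>) - (f \<epsilon> 0 + b \<epsilon> * r \<epsilon>)\<bar> \<le> inverse \<epsilon> ^ N * \<bar>r \<epsilon>\<bar> ^ 2"
      using elim by (auto simp: numeral_2_eq_2 b_def)
    have "inverse \<epsilon> ^ N * \<bar>r \<epsilon>\<bar> ^ 2 \<le> inverse \<epsilon> ^ N * (\<epsilon> ^ k) ^ 2"
      using rabs elim by (intro mult_left_mono power_mono) auto
    also have "\<dots> = \<epsilon> ^ k * \<epsilon> ^ Suc m"
      using elim by (simp add: k_def power2_eq_square power_add power_inverse)
    also have "\<dots> \<le> \<epsilon> ^ k * \<epsilon> ^ m" using elim by (intro mult_left_mono power_decreasing) auto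
    finally have R: "inverse \<epsilon> ^ N * \<bar>r \<epsilon>\<bar> ^ 2 \<le> \<epsilon> ^ k * \<epsilon> ^ m" .
    have br: "b \<epsilon> * r \<epsilon> = - (\<epsilon> ^ k * \<bar>b \<epsilon>\<bar>)" by (simp add: reps abs_sgn)
    have "- (\<epsilon> ^ k * \<epsilon> ^ m) \<le> f \<epsilon> (r \<epsilon>) - f \<epsilon> 0" using elim by (simp add: power_add)
    then have "\<epsilon> ^ k * \<bar>b \<epsilon>\<bar> \<le> \<epsilon> ^ k * \<epsilon> ^ m + \<epsilon> ^ k * \<epsilon> ^ m" using T R br by linarith
    then have "\<epsilon> ^ k * \<bar>b \<epsilon>\<bar> \<le> \<epsilon> ^ k * (2 * \<epsilon> ^ m)" by simp
    then show ?case using elim by (simp add: b_def)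
  qed
qed

text \<open>
  With step \<open>h = \<epsilon>\<^sup>k\<close>, the lower bound from minimality, the linear term and the cubic remainder are each
  at most \<open>h\<^sup>2 \<epsilon>\<^sup>m\<close> in size. Hence half the second derivative is at least \<open>-3 \<epsilon>\<^sup>m\<close>.
\<close>

lemma nonneg_second_derivative: "0 \<le> abs_gen_real (\<lambda>\<epsilon>. iter_pderiv [1, 1] (f \<epsilon>) 0)"
proof (rule abs_gen_real_nonnegI[where C = 6])
  define b where "b \<epsilon> = iter_pderiv [1] (f \<epsilon>) 0" for \<epsilon>
  define c where "c \<epsilon> = iter_pderiv [1, 1] (f \<epsilon>) 0" for \<epsilon>
  show "moderate (\<lambda>\<epsilon>. iter_pderiv [1, 1] (f \<epsilon>) 0)"
    using moderate_nets_bound[OF f, of "{0}" 2] zero_in_J by (simp add: moderate_iff numeral_2_eq_2)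
  fix m
  obtain d where d: "d > 0" "{-d..d} \<subseteq> J" using exists_symmetric_interval by blast
  obtain N where N: "\<forall>\<^sub>F \<epsilon> in at_right 0. \<forall>x\<in>{-d..d}.
    \<bar>f \<epsilon> x - (\<Sum>m<3. iter_pderiv (replicate m 1) (f \<epsilon>) 0 / fact m * x ^ m)\<bar> \<le> inverse \<epsilon> ^ N * \<bar>x\<bar> ^ 3"
    using taylor_estimate[OF f _ d(2), of 3] d(1) by auto
  \<comment> \<open>One power of the step pays for the moderate bound and leaves a factor \<open>\<epsilon>\<^sup>m\<close>; the successor makes
    the exponent positive, so that the step tends to \<open>0\<close> and the truncation is eventually inactive.\<close>
  define k where "k = Suc (N + m)"
  define r where "r \<epsilon> = 1 * min d (\<epsilon> ^ k)" for \<epsilon>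
  have r: "r \<in> compact_nets J" unfolding r_def using d by (intro test_net) auto
  have nb: "\<forall>\<^sub>F \<epsilon> in at_right 0. \<bar>b \<epsilon>\<bar> \<le> \<epsilon> ^ (k + m)"
    unfolding b_def by (rule negligible_netD[OF negligible_first_derivative])
  show "\<forall>\<^sub>F \<epsilon> in at_right 0. - (6 * \<epsilon> ^ m) \<le> iter_pderiv [1, 1] (f \<epsilon>) 0"
    using N eventually_increment_ge[OF r, of "2 * k + m"] eventually_power_le[OF d(1), of "N + m"] eventually_small nb
  proof eventually_elim
    case (elim \<epsilon>)
    have reps: "r \<epsilon> = \<epsilon> ^ k" using elim by (simp add: r_def k_def)
    have "0 \<le> r \<epsilon>" "r \<epsilon> \<le> d" using reps elim by (simp_all add: k_def)
    then have "r \<epsilon> \<in> {-d..d}" using d(1) by simp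
    then have T: "\<bar>f \<epsilon> (r \<epsilon>) - (f \<epsilon> 0 + b \<epsilon> * r \<epsilon> + c \<epsilon> / 2 * (r \<epsilon>)\<^sup>2)\<bar> \<le> inverse \<epsilon> ^ N * \<bar>r \<epsilon>\<bar> ^ 3"
      using elim by (auto simp: numeral_2_eq_2 numeral_3_eq_3 b_def c_def)
    have "inverse \<epsilon> ^ N * \<bar>r \<epsilon>\<bar> ^ 3 = (\<epsilon> ^ k)\<^sup>2 * \<epsilon> ^ Suc m"
      using elim by (simp add: reps k_def power2_eq_square power3_eq_cube power_add power_inverse)
    also have "\<dots> \<le> (\<epsilon> ^ k)\<^sup>2 * \<epsilon> ^ m" using elim by (intro mult_left_mono power_decreasing) auto
    finally have R: "inverse \<epsilon> ^ N * \<bar>r \<epsilon>\<bar> ^ 3 \<le> (\<epsilon> ^ k)\<^sup>2 * \<epsilon> ^ m" .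
    have "b \<epsilon> * r \<epsilon> \<le> \<epsilon> ^ (k + m) * \<epsilon> ^ k"
      unfolding reps using elim by (intro mult_right_mono) auto
    then have br: "b \<epsilon> * r \<epsilon> \<le> (\<epsilon> ^ k)\<^sup>2 * \<epsilon> ^ m" by (simp add: power_add power2_eq_square mult_ac)
    have "- ((\<epsilon> ^ k)\<^sup>2 * \<epsilon> ^ m) \<le> f \<epsilon> (r \<epsilon>) - f \<epsilon> 0"
      using elim by (simp add: power_add power_mult[symmetric] mult.commute)
    then have "0 \<le> c \<epsilon> / 2 * (r \<epsilon>)\<^sup>2 + 3 * ((\<epsilon> ^ k)\<^sup>2 * \<epsilon> ^ m)" using T R br by linarith
    then have "0 \<le> (\<epsilon> ^ k)\<^sup>2 * (c \<epsilon> / 2 + 3 * \<epsilon> ^ m)" unfolding reps by (simp only: algebra_simps)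
    moreover have "0 < (\<epsilon> ^ k)\<^sup>2" using elim by simp
    ultimately have "0 \<le> c \<epsilon> / 2 + 3 * \<epsilon> ^ m" by (simp only: zero_le_mult_iff) linarith
    then show ?case by (simp add: c_def)
  qed
qed simp

end

text \<open>
  The element of the algebra picked by the choice operator in \<open>deriv_at_zero\<close> enters only through one of
  its representatives \<open>f\<close>, whose values at compactly supported points represent those of \<open>F\<close>.
\<close>

lemma deriv_at_zero_minimum:
  assumes ex: "\<exists>g. has_point_values J F g" and min: "\<And>s. F 0 \<le> F s"
  shows "deriv_at_zero J 1 F = 0" "0 \<le> deriv_at_zero J 2 F"
proof -
  define g where "g = (SOME g. has_point_values J F g)"
  have g: "has_point_values J F g" unfolding g_def using ex by (rule someI_ex)
  then have gc: "g \<in> colombeau J J" by (simp add: has_point_values_def)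
  obtain f where fg: "f \<in> g" using colombeau_nonempty[OF gc] ..
  note f = colombeau_class[OF gc fg]
  have F: "F (abs_gen_real r) = abs_gen_real (\<lambda>\<epsilon>. f \<epsilon> (r \<epsilon>))" if "r \<in> compact_nets J" for r
    using g that point_value_eq[OF f(1) that] f(2) by (auto simp: has_point_values_def compact_points_def)
  have minf: "abs_gen_real (\<lambda>\<epsilon>. f \<epsilon> 0) \<le> abs_gen_real (\<lambda>\<epsilon>. f \<epsilon> (r \<epsilon>))" if "r \<in> compact_nets J" for r
    using min[of "abs_gen_real r"] F[OF that] F[OF zero_compact_net] by (simp add: zero_gen_real.abs_eq)
  have d: "deriv_at_zero J k F = abs_gen_real (\<lambda>\<epsilon>. iter_pderiv (replicate k 1) (f \<epsilon>) 0)" for k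
    unfolding deriv_at_zero_def g_def[symmetric] by (rule gf_pderiv_value_at_zero[OF gc fg])
  note neg = negligible_first_derivative[OF f(1) minf]
  show "deriv_at_zero J 1 F = 0"
    using d[of 1] neg abs_gen_real_eq_0_iff[OF negligible_imp_moderate[OF neg]] by simp
  show "0 \<le> deriv_at_zero J 2 F"
    using d[of 2] nonneg_second_derivative[OF f(1) minf] by (simp add: numeral_2_eq_2)
qed

end

theorem proposition3p1:
  fixes \<Omega> D :: "(real ^ 'n) set"
    and A A0 :: "(real ^ 'n) gen_fun set"
    and L :: "(real ^ 'n) gen_fun \<Rightarrow> gen_real"
    and J :: "(real ^ 'n) gen_fun \<Rightarrow> (real ^ 'n) gen_fun \<Rightarrow> real set"
    and u :: "(real ^ 'n) gen_fun"
  assumes "open \<Omega>"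
    and "D = \<Omega> \<or> D = closure \<Omega>"
    and "A \<subseteq> colombeau \<Omega> D"
    and "gf_submodule \<Omega> D A0"
    and "\<And>w v. w \<in> A \<Longrightarrow> v \<in> A0 \<Longrightarrow> gf_add \<Omega> D w v \<in> A"
    and "\<And>w v. w \<in> A \<Longrightarrow> v \<in> A0 \<Longrightarrow> open (J w v) \<and> is_interval (J w v) \<and> 0 \<in> J w v"
    and "\<And>w v. w \<in> A \<Longrightarrow> v \<in> A0 \<Longrightarrow> \<exists>g. has_point_values (J w v) (along_line \<Omega> D L w v) g"
    and "u \<in> A"
    and "\<And>w. w \<in> A \<Longrightarrow> L u \<le> L w"
  shows "(\<forall>v\<in>A0. first_variation \<Omega> D (J u v) L u v = 0) \<and>
    (\<forall>v\<in>A0. second_variation \<Omega> D (J u v) L u v \<ge> 0)"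
proof -
  interpret smooth_domain \<Omega> D
    by unfold_locales (use assms(1,2) closure_subset in auto)
  have "first_variation \<Omega> D (J u v) L u v = 0 \<and> second_variation \<Omega> D (J u v) L u v \<ge> 0"
    if v: "v \<in> A0" for v
  proof -
    \<comment> \<open>\<open>L u\<close> is the value at \<open>0\<close> of the function on the line, which is thus minimal there.\<close>
    have start: "along_line \<Omega> D L u v 0 = L u"
      using assms(3,4,8) v by (auto simp: along_line_def gf_submodule_def gf_add_scale_0 subset_iff)
    interpret interval_around_zero "J u v"
      by unfold_locales (use assms(6)[OF assms(8) v] in auto)
    have "L u \<le> along_line \<Omega> D L u v s" for s
      using assms(4,5,8,9) v by (auto simp: along_line_def gf_submodule_def)
    then show ?thesis
      using deriv_at_zero_minimum[OF assms(7)[OF assms(8) v]] start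
      by (simp add: first_variation_def second_variation_def)
  qed
  then show ?thesis by blast
qed

end
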